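(* Let $g\ge1$, let $m$ be a symmetric positive-definite half-integral $g\times g$ matrix, $n\in\mathbb{N}$, $r\in\mathbb{Z}^g$ (row vector) with $4n>m^{-1}[r^t]$, and let $k>g+2$ be an integer. Let $p$ be an odd prime and $\mu\in\mathbb{N}$. Suppose $p$ divides every entry of $m$ and every entry of $r$, and $p\nmid n$. If $P^{k,p^\mu m}_{p^\mu n,p^\mu r}\not\equiv0$, then either $P^{k,p^{\mu-1}m}_{p^{\mu-1}n,p^{\mu-1}r}\not\equiv0$, or both $P^{k,p^{2\mu}m}_{p^{2\mu}n,p^{2\mu}r}\not\equiv0$ and $P^{k,p^{2\mu}m}_{n,p^{\mu}r}\not\equiv 0$.
   Context: Notation: $e(z)=e^{2\pi iz}$; $A[B]=B^tAB$; $m$ half-integral means $2m$ has integer entries and even diagonal; "$p$ divides every entry of $m$" makes sense since $p$ is odd (equivalently $p$ divides every entry of $2m$). The Jacobi group $\Gamma^J_g=SL(2,\mathbb{Z})\ltimes(\mathbb{Z}^g\times\mathbb{Z}^g)$ acts on functions $\phi:\mathcal H\times\mathbb{C}^g\to\mathbb{C}$ by $\phi|_{k,m}\gamma(\tau,z)=(c\tau+d)^{-k}e\big(-c(c\tau+d)^{-1}m[z+\lambda\tau+\mu]+m[\lambda]+2\lambda^tmz\big)\phi\left(\frac{a\tau+b}{c\tau+d},(c\tau+d)^{-1}(z+\lambda\tau+\mu)\right)$ for $\gamma=(\begin{pmatrix}a&b\\c&d\end{pmatrix},(\lambda,\mu))$. For $k>g+2$ and $(n,r)$ with $4n>m^{-1}[r^t]$,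 $P^{k,m}_{n,r}=\sum_{\gamma\in\Gamma^J_{g,\infty}\backslash\Gamma^J_g}e(n\tau+rz)|_{k,m}\gamma$, with $\Gamma^J_{g,\infty}=\{(\begin{pmatrix}1&t\\0&1\end{pmatrix},(0,\mu)):t\in\mathbb{Z},\mu\in\mathbb{Z}^g\}$; it is a Jacobi cusp form of weight $k$, index $m$, degree $g$.
   Formalization: In the slash action defining the Poincaré series, the term m[λ] of the exponent is corrected to m[λ]τ; as printed it is not a group action and the summands would depend on the chosen coset representatives. *)

theory Defs
  imports
    "HOL-Analysis.Analysis"
    "HOL-Algebra.Coset"
    "HOL-Computational_Algebra.Primes"
begin

text \<open>The degree \<open>g\<close> is \<open>CARD('g)\<close> for a finite index type \<open>'g\<close>, so \<open>g \<ge> 1\<close> is automatic.\<close>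

section \<open>Quadratic forms and half-integral matrices\<close>

definition bilin :: "'a::comm_ring_1 ^'g ^'g \<Rightarrow> 'a ^'g \<Rightarrow> 'a ^'g \<Rightarrow> 'a" where
  "bilin A x y = (\<Sum>i\<in>UNIV. \<Sum>j\<in>UNIV. x $ i * A $ i $ j * y $ j)"

text \<open>\<open>qform A B\<close> is \<open>A[B] = B\<^sup>t A B\<close>.\<close>

definition qform :: "'a::comm_ring_1 ^'g ^'g \<Rightarrow> 'a ^'g \<Rightarrow> 'a" where
  "qform A x = bilin A x x"

definition of_int_vec :: "int ^'g \<Rightarrow> 'a::ring_1 ^'g" where
  "of_int_vec x = (\<chi> i. of_int (x $ i))"

definition positive_definite :: "real ^'g ^'g \<Rightarrow> bool" where
  "positive_definite m \<longleftrightarrow> (\<forall>x. x \<noteq> 0 \<longrightarrow> qform m x > 0)"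

definition half_integral :: "real ^'g ^'g \<Rightarrow> bool" where
  "half_integral m \<longleftrightarrow>
     (\<exists>M :: int ^'g ^'g. (\<forall>i j. 2 * m $ i $ j = of_int (M $ i $ j)) \<and> (\<forall>i. even (M $ i $ i)))"

text \<open>Divisibility of the entries of a half-integral matrix \<open>m\<close> by an odd number \<open>p\<close>
  means divisibility of the integer entries of \<open>2m\<close>.\<close>

definition divides_entries :: "nat \<Rightarrow> real ^'g ^'g \<Rightarrow> bool" where
  "divides_entries p m \<longleftrightarrow> (\<forall>i j. \<exists>c::int. 2 * m $ i $ j = of_int (int p * c))"

section \<open>The Jacobi group\<close>

text \<open>An element is \<open>(M, (\<lambda>, \<mu>))\<close>, and \<open>(M, X)(M', X') = (M M', X M' + X')\<close>, where
  \<open>(\<lambda>, \<mu>)\<close> is regarded as a \<open>g \<times> 2\<close> matrix acted on from the right by \<open>SL(2, \<int>)\<close>.\<close>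

type_synonym 'g jacobi_elem = "(int ^2 ^2) \<times> ((int ^'g) \<times> (int ^'g))"

fun jacobi_mult :: "'g::finite jacobi_elem \<Rightarrow> 'g jacobi_elem \<Rightarrow> 'g jacobi_elem" where
  "jacobi_mult (M, (l, u)) (M', (l', u')) =
     (M ** M', (M' $ 1 $ 1 *s l + M' $ 2 $ 1 *s u + l', M' $ 1 $ 2 *s l + M' $ 2 $ 2 *s u + u'))"

definition jacobi_group :: "'g::finite jacobi_elem monoid" where
  "jacobi_group = \<lparr>carrier = {(M, X). det M = 1}, mult = jacobi_mult, one = (mat 1, (0, 0))\<rparr>"

definition jacobi_inf :: "'g::finite jacobi_elem set" where
  "jacobi_inf = {(vector [vector [1, t], vector [0, 1]], (0, u)) | t u. True}"

section \<open>The slash action and Poincar\'e series\<close>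

definition e :: "complex \<Rightarrow> complex" where
  "e z = exp (2 * of_real pi * \<i> * z)"

text \<open>The index-\<open>m\<close> automorphy factor contains \<open>m[\<lambda>]\<tau>\<close>. The factor \<open>\<tau>\<close>, occasionally dropped in
  print, is what makes this an action, so that the summands of the Poincar\'e series below depend
  only on the coset (lemma \<open>jacobi_slash_jacobi_exp_coset\<close>).\<close>

fun jacobi_slash ::
    "int \<Rightarrow> real ^'g ^'g \<Rightarrow> (complex \<Rightarrow> complex ^'g \<Rightarrow> complex) \<Rightarrow> 'g::finite jacobi_elem
      \<Rightarrow> complex \<Rightarrow> complex ^'g \<Rightarrow> complex" where
  "jacobi_slash k m \<phi> (M, (l, u)) \<tau> z =
     (let a = of_int (M $ 1 $ 1); b = of_int (M $ 1 $ 2);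
          c = of_int (M $ 2 $ 1); d = of_int (M $ 2 $ 2);
          m' = map_matrix complex_of_real m;
          w = z + \<tau> *s of_int_vec l + of_int_vec u
      in (c * \<tau> + d) powi (- k)
         * e (- c / (c * \<tau> + d) * qform m' w + qform m' (of_int_vec l) * \<tau>
              + 2 * bilin m' (of_int_vec l) z)
         * \<phi> ((a * \<tau> + b) / (c * \<tau> + d)) ((1 / (c * \<tau> + d)) *s w))"

definition jacobi_exp :: "nat \<Rightarrow> int ^'g \<Rightarrow> complex \<Rightarrow> complex ^'g \<Rightarrow> complex" where
  "jacobi_exp n r \<tau> z = e (of_nat n * \<tau> + (\<Sum>i\<in>UNIV. of_int (r $ i) * z $ i))"

definition jacobi_poincare ::
    "int \<Rightarrow> real ^'g ^'g \<Rightarrow> nat \<Rightarrow> int ^'g::finite \<Rightarrow> complex \<Rightarrow> complex ^'g \<Rightarrow> complex" where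
  "jacobi_poincare k m n r \<tau> z =
     (\<Sum>\<^sub>\<infinity>C \<in> rcosets\<^bsub>jacobi_group\<^esub> jacobi_inf.
        jacobi_slash k m (jacobi_exp n r) (SOME \<gamma>. \<gamma> \<in> C) \<tau> z)"

definition not_identically_zero :: "(complex \<Rightarrow> complex ^'g \<Rightarrow> complex) \<Rightarrow> bool" where
  "not_identically_zero \<phi> \<longleftrightarrow> (\<exists>\<tau> z. Im \<tau> > 0 \<and> \<phi> \<tau> z \<noteq> 0)"

section \<open>Well-definedness\<close>

lemma group_jacobi_group: "group (jacobi_group :: 'g::finite jacobi_elem monoid)"
proof (rule groupI)
  fix x y z :: "'g jacobi_elem"
  obtain M l u where x: "x = (M, (l, u))" by (cases x) auto
  obtain M' l' u' where y: "y = (M', (l', u'))" by (cases y) auto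
  obtain M'' l'' u'' where z: "z = (M'', (l'', u''))" by (cases z) auto
  show "(x \<otimes>\<^bsub>jacobi_group\<^esub> y) \<otimes>\<^bsub>jacobi_group\<^esub> z = x \<otimes>\<^bsub>jacobi_group\<^esub> (y \<otimes>\<^bsub>jacobi_group\<^esub> z)"
    by (simp add: x y z jacobi_group_def matrix_mul_assoc vec_eq_iff algebra_simps)
       (simp add: matrix_matrix_mult_def sum_2 algebra_simps)
next
  fix x :: "'g jacobi_elem" assume x: "x \<in> carrier jacobi_group"
  obtain M l u where xe: "x = (M, (l, u))" by (cases x) auto
  have d: "M $ 1 $ 1 * M $ 2 $ 2 - M $ 1 $ 2 * M $ 2 $ 1 = 1"
    using x by (simp add: xe jacobi_group_def det_2)
  define N :: "int ^2 ^2" where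
    "N = vector [vector [M $ 2 $ 2, - M $ 1 $ 2], vector [- M $ 2 $ 1, M $ 1 $ 1]]"
  have N: "N $ 1 $ 1 = M $ 2 $ 2" "N $ 1 $ 2 = - M $ 1 $ 2"
          "N $ 2 $ 1 = - M $ 2 $ 1" "N $ 2 $ 2 = M $ 1 $ 1"
    by (simp_all add: N_def vector_2)
  have NM: "N ** M = mat 1"
    using d by (simp add: matrix_matrix_mult_def mat_def vec_eq_iff forall_2 sum_2 N algebra_simps)
  define y :: "'g jacobi_elem" where
    "y = (N, (- (M $ 2 $ 2 *s l - M $ 2 $ 1 *s u), - (- M $ 1 $ 2 *s l + M $ 1 $ 1 *s u)))"
  have "y \<in> carrier jacobi_group"
    using d by (simp add: y_def jacobi_group_def det_2 N algebra_simps)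
  moreover have "y \<otimes>\<^bsub>jacobi_group\<^esub> x = \<one>\<^bsub>jacobi_group\<^esub>"
  proof -
    have "M $ 2 $ 1 * M $ 1 $ 2 * s - M $ 1 $ 1 * M $ 2 $ 2 * s + s = 0"
         "M $ 1 $ 2 * M $ 2 $ 1 * s - M $ 2 $ 2 * M $ 1 $ 1 * s + s = 0" for s
      using d by algebra+
    thus ?thesis
      by (simp add: y_def xe jacobi_group_def NM vec_eq_iff algebra_simps)
  qed
  ultimately show "\<exists>y\<in>carrier jacobi_group. y \<otimes>\<^bsub>jacobi_group\<^esub> x = \<one>\<^bsub>jacobi_group\<^esub>" by blast
qed (auto simp: jacobi_group_def det_mul)

lemma subgroup_jacobi_inf:
  "subgroup (jacobi_inf :: 'g::finite jacobi_elem set) jacobi_group"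
proof -
  interpret group "jacobi_group :: 'g jacobi_elem monoid" by (rule group_jacobi_group)
  let ?T = "\<lambda>t::int. vector [vector [1, t], vector [0, 1]] :: int ^2 ^2"
  have mult: "(?T t, (0::int^'g, u)) \<otimes>\<^bsub>jacobi_group\<^esub> (?T t', (0, u')) = (?T (t + t'), (0, u + u'))"
    for t t' u u'
    by (simp add: jacobi_group_def vec_eq_iff vector_2 forall_2 matrix_matrix_mult_def sum_2)
  have one: "\<one>\<^bsub>jacobi_group\<^esub> = (?T 0, (0::int^'g, 0))"
    by (simp add: jacobi_group_def mat_def vec_eq_iff vector_2 forall_2)
  have car: "(?T t, (0::int^'g, u)) \<in> carrier jacobi_group" for t u
    by (simp add: jacobi_group_def det_2 vector_2)
  have inv: "inv\<^bsub>jacobi_group\<^esub> (?T t, (0::int^'g, u)) = (?T (- t), (0, - u))" for t u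
    by (rule inv_equality) (simp_all add: mult one car)
  show ?thesis
  proof (rule subgroupI)
    show "(jacobi_inf :: 'g jacobi_elem set) \<subseteq> carrier jacobi_group"
      using car by (auto simp: jacobi_inf_def)
    show "(jacobi_inf :: 'g jacobi_elem set) \<noteq> {}"
      by (auto simp: jacobi_inf_def)
    show "inv\<^bsub>jacobi_group\<^esub> x \<in> jacobi_inf" if "x \<in> jacobi_inf" for x :: "'g jacobi_elem"
      using that by (auto simp: jacobi_inf_def inv)
    show "x \<otimes>\<^bsub>jacobi_group\<^esub> y \<in> jacobi_inf" if "x \<in> jacobi_inf" "y \<in> jacobi_inf"
      for x y :: "'g jacobi_elem"
      using that by (auto simp: jacobi_inf_def mult)
  qed
qed

lemma bilin_add_left: "bilin A (x + y) z = bilin A x z + bilin A y z"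
  by (simp add: bilin_def algebra_simps sum.distrib)

lemma bilin_add_right: "bilin A x (y + z) = bilin A x y + bilin A x z"
  by (simp add: bilin_def algebra_simps sum.distrib)

lemma bilin_scale_left: "bilin A (c *s x) y = c * bilin A x y"
  by (simp add: bilin_def sum_distrib_left algebra_simps)

lemma bilin_scale_right: "bilin A x (c *s y) = c * bilin A x y"
  by (simp add: bilin_def sum_distrib_left algebra_simps)

lemma bilin_commute:
  assumes "transpose A = A"
  shows "bilin A x y = bilin A y x"
proof -
  have s: "A $ i $ j = A $ j $ i" for i j
    using assms by (metis transpose_def vec_lambda_beta)
  have "bilin A x y = (\<Sum>j\<in>UNIV. \<Sum>i\<in>UNIV. x $ i * A $ i $ j * y $ j)"
    unfolding bilin_def by (rule sum.swap)
  also have "\<dots> = bilin A y x"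
    unfolding bilin_def by (intro sum.cong refl) (metis s mult.commute mult.assoc)
  finally show ?thesis .
qed

lemma e_add: "e (x + y) = e x * e y"
  by (simp add: e_def distrib_left exp_add)

lemma e_Ints:
  assumes "x \<in> \<int>" shows "e x = 1"
proof -
  from assms obtain i where i: "x = of_int i" by (elim Ints_cases)
  show ?thesis using exp_integer_2pi[of "of_int i"] by (simp add: e_def i mult_ac)
qed

lemma half_integral_entry:
  assumes "half_integral m"
  shows "2 * complex_of_real (m $ i $ j) \<in> \<int>"
proof -
  from assms obtain c :: int where c: "2 * m $ i $ j = of_int c"
    unfolding half_integral_def by blast
  have "2 * complex_of_real (m $ i $ j) = complex_of_real (2 * m $ i $ j)" by simp
  also have "\<dots> = of_int c" unfolding c by simp
  finally show ?thesis by simp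
qed

lemma half_integral_diag:
  assumes "half_integral m"
  shows "complex_of_real (m $ i $ i) \<in> \<int>"
proof -
  from assms obtain M :: "int ^'a ^'a" where M: "2 * m $ i $ i = of_int (M $ i $ i)" "even (M $ i $ i)"
    unfolding half_integral_def by blast
  then obtain c where "M $ i $ i = 2 * c" by (elim evenE)
  with M have "m $ i $ i = of_int c" by simp
  thus ?thesis by simp
qed

lemma two_bilin_Ints:
  fixes m :: "real ^'g ^'g"
  assumes "half_integral m"
  shows "2 * bilin (map_matrix complex_of_real m) (of_int_vec x) (of_int_vec y) \<in> \<int>"
proof -
  have "2 * bilin (map_matrix complex_of_real m) (of_int_vec x) (of_int_vec y)
      = (\<Sum>i\<in>UNIV. \<Sum>j\<in>UNIV. of_int (x $ i) * (2 * complex_of_real (m $ i $ j)) * of_int (y $ j))"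
    by (simp add: bilin_def of_int_vec_def sum_distrib_left mult_ac)
  also have "\<dots> \<in> \<int>"
    by (intro Ints_sum Ints_mult half_integral_entry[OF assms] Ints_of_int)
  finally show ?thesis .
qed

lemma jacobi_slash_jacobi_exp_coset:
  fixes m :: "real ^'g ^'g"
  assumes m: "transpose m = m" "half_integral m"
    and \<gamma>: "\<gamma> \<in> carrier jacobi_group" and \<delta>: "\<delta> \<in> jacobi_inf" and \<tau>: "Im \<tau> > 0"
  shows "jacobi_slash k m (jacobi_exp n r) (\<delta> \<otimes>\<^bsub>jacobi_group\<^esub> \<gamma>) \<tau> z =
         jacobi_slash k m (jacobi_exp n r) \<gamma> \<tau> z"
proof -
  obtain M l u where g: "\<gamma> = (M, (l, u))" by (cases \<gamma>) auto
  obtain t v where dl: "\<delta> = (vector [vector [1, t], vector [0, 1]], (0, v))"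
    using \<delta> by (auto simp: jacobi_inf_def)
  define a b c d where abcd: "a = M $ 1 $ 1" "b = M $ 1 $ 2" "c = M $ 2 $ 1" "d = M $ 2 $ 2"
  have det: "a * d - b * c = 1" using \<gamma> by (simp add: g jacobi_group_def det_2 abcd)
  define J where "J = of_int c * \<tau> + of_int d"
  have J0: "J \<noteq> 0"
  proof
    assume J: "J = 0"
    hence "Im J = 0" by simp
    hence "c = 0" using \<tau> by (simp add: J_def)
    moreover from this J have "d = 0" by (simp add: J_def)
    ultimately show False using det by simp
  qed
  have *: "\<delta> \<otimes>\<^bsub>jacobi_group\<^esub> \<gamma> =
     (vector [vector [a + t * c, b + t * d], vector [c, d]], (l + c *s v, u + d *s v))"
    by (simp add: g dl jacobi_group_def abcd vec_eq_iff vector_2 forall_2 matrix_matrix_mult_def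
                  sum_2 algebra_simps)
  let ?m = "map_matrix complex_of_real m"
  let ?l = "of_int_vec l :: complex ^'g" and ?u = "of_int_vec u :: complex ^'g"
    and ?v = "of_int_vec v :: complex ^'g"
  define w where "w = z + \<tau> *s ?l + ?u"
  define w' where "w' = z + \<tau> *s of_int_vec (l + c *s v) + of_int_vec (u + d *s v)"
  have lv: "of_int_vec (l + c *s v) = ?l + of_int c *s ?v"
    by (simp add: of_int_vec_def vec_eq_iff)
  have w': "w' = w + J *s ?v"
    by (simp add: w_def w'_def of_int_vec_def vec_eq_iff J_def algebra_simps)
  have sym: "transpose ?m = ?m"
    using m(1) by (simp add: transpose_def vec_eq_iff)
  note comm = bilin_commute[OF sym]
  define K where "K = - (of_int c * (2 * bilin ?m ?v ?u)) - of_int (c * d) * qform ?m ?v"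
  have qw': "qform ?m w' = qform ?m w + 2 * J * bilin ?m ?v w + J\<^sup>2 * qform ?m ?v"
    unfolding w' qform_def
    by (simp add: bilin_add_left bilin_add_right bilin_scale_left bilin_scale_right comm[of w ?v]
                  power2_eq_square algebra_simps)
  have ql: "qform ?m (?l + of_int c *s ?v) =
              qform ?m ?l + 2 * of_int c * bilin ?m ?v ?l + (of_int c)\<^sup>2 * qform ?m ?v"
    unfolding qform_def
    by (simp add: bilin_add_left bilin_add_right bilin_scale_left bilin_scale_right comm[of ?l ?v]
                  power2_eq_square algebra_simps)
  have bw: "bilin ?m ?v w = bilin ?m ?v z + \<tau> * bilin ?m ?v ?l + bilin ?m ?v ?u"
    unfolding w_def by (simp add: bilin_add_right bilin_scale_right)
  have arg: "- of_int c / J * qform ?m w' + qform ?m (?l + of_int c *s ?v) * \<tau>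
              + 2 * bilin ?m (?l + of_int c *s ?v) z
      = (- of_int c / J * qform ?m w + qform ?m ?l * \<tau> + 2 * bilin ?m ?l z) + K"
    using J0 unfolding qw' ql K_def
    by (simp add: bilin_add_left bilin_scale_left bw field_simps power2_eq_square)
       (simp add: J_def algebra_simps)
  have "qform ?m ?v \<in> \<int>"
  proof -
    define E where "E = (\<lambda>i j. of_int (v $ i) * complex_of_real (m $ i $ j) * of_int (v $ j))"
    have tri: "(\<Sum>i\<in>S. \<Sum>j\<in>S. E i j) \<in> \<int>" if "finite S" for S
      using that
    proof (induction S)
      case (insert x S)
      have Es: "E i j = E j i" for i j
      proof -
        have "m $ i $ j = m $ j $ i" using m(1) by (metis transpose_def vec_lambda_beta)
        thus ?thesis by (simp add: E_def)
      qed
      have "(\<Sum>i\<in>insert x S. \<Sum>j\<in>insert x S. E i j)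
              = E x x + (\<Sum>j\<in>S. E x j) + ((\<Sum>i\<in>S. E i x) + (\<Sum>i\<in>S. \<Sum>j\<in>S. E i j))"
        using insert by (simp add: sum.distrib)
      also have "(\<Sum>i\<in>S. E i x) = (\<Sum>j\<in>S. E x j)" by (simp add: Es)
      also have "E x x + (\<Sum>j\<in>S. E x j) + ((\<Sum>j\<in>S. E x j) + (\<Sum>i\<in>S. \<Sum>j\<in>S. E i j))
          = E x x + (\<Sum>j\<in>S. 2 * E x j) + (\<Sum>i\<in>S. \<Sum>j\<in>S. E i j)"
        by (simp add: sum_distrib_left[symmetric])
      also have "\<dots> \<in> \<int>"
      proof (intro Ints_add Ints_sum[of S "\<lambda>j. 2 * E x j"])
        show "E x x \<in> \<int>"
          unfolding E_def by (intro Ints_mult half_integral_diag[OF m(2)] Ints_of_int)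
        show "2 * E x j \<in> \<int>" for j
        proof -
          have "2 * E x j = of_int (v $ x) * (2 * complex_of_real (m $ x $ j)) * of_int (v $ j)"
            by (simp add: E_def)
          also have "\<dots> \<in> \<int>" by (intro Ints_mult half_integral_entry[OF m(2)] Ints_of_int)
          finally show ?thesis .
        qed
      qed (use insert in auto)
      finally show ?case .
    qed simp
    show ?thesis using tri[of UNIV] by (simp add: E_def qform_def bilin_def of_int_vec_def)
  qed
  hence "K \<in> \<int>"
    unfolding K_def by (intro Ints_diff Ints_minus Ints_mult two_bilin_Ints[OF m(2)] Ints_of_int)
  hence eK: "e K = 1" by (rule e_Ints)
  have exp: "jacobi_exp n r (x + of_int t) (y + ?v) = jacobi_exp n r x y" for x y
  proof -
    let ?L = "of_nat n * of_int t + (\<Sum>i\<in>UNIV. of_int (r $ i) * of_int (v $ i)) :: complex"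
    have "?L \<in> \<int>" by (intro Ints_add Ints_mult Ints_sum Ints_of_int Ints_of_nat)
    hence eL: "e (x + ?L) = e x" for x
      by (simp only: e_add[of x ?L] e_Ints[of ?L] mult_1_right)
    have "of_nat n * (x + of_int t) + (\<Sum>i\<in>UNIV. of_int (r $ i) * (y + ?v) $ i)
       = (of_nat n * x + (\<Sum>i\<in>UNIV. of_int (r $ i) * y $ i)) + ?L"
      by (simp add: of_int_vec_def algebra_simps sum.distrib)
    thus ?thesis unfolding jacobi_exp_def by (simp only: eL)
  qed
  have t1: "(of_int (a + t * c) * \<tau> + of_int (b + t * d)) / J
              = (of_int a * \<tau> + of_int b) / J + of_int t"
    using J0 by (simp add: field_simps) (simp add: J_def algebra_simps)
  have t2: "(1 / J) *s w' = (1 / J) *s w + ?v"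
    using J0 by (simp add: w' vec_eq_iff field_simps)
  have "jacobi_slash k m (jacobi_exp n r) (\<delta> \<otimes>\<^bsub>jacobi_group\<^esub> \<gamma>) \<tau> z =
      J powi (- k) * e (- of_int c / J * qform ?m w' + qform ?m (?l + of_int c *s ?v) * \<tau>
              + 2 * bilin ?m (?l + of_int c *s ?v) z)
      * jacobi_exp n r ((of_int (a + t * c) * \<tau> + of_int (b + t * d)) / J) ((1 / J) *s w')"
    unfolding * jacobi_slash.simps Let_def J_def w'_def vector_2 lv ..
  also have "\<dots> = J powi (- k) * e (- of_int c / J * qform ?m w + qform ?m ?l * \<tau> + 2 * bilin ?m ?l z)
      * jacobi_exp n r ((of_int a * \<tau> + of_int b) / J) ((1 / J) *s w)"
    unfolding arg t1 t2 exp e_add eK by simp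
  also have "\<dots> = jacobi_slash k m (jacobi_exp n r) \<gamma> \<tau> z"
    unfolding g jacobi_slash.simps Let_def J_def w_def abcd ..
  finally show ?thesis .
qed

end

theory Submission
  imports Defs
begin

text \<open>
  Write \<open>x\<^sub>j\<close> for the Poincar\'e series of index \<open>p\<^sup>j m\<close> attached to \<open>(p\<^sup>j n, p\<^sup>j r)\<close>, put
  \<open>U\<phi>(\<tau>, z) = \<phi>(\<tau>, pz)\<close>, and let \<open>V\<close> be the index raising Hecke operator
  \<open>V\<phi>(\<tau>, z) = \<phi>(p\<tau>, pz) + p\<^bsup>-k\<^esup> \<Sum>\<^bsub>t mod p\<^esub> \<phi>((\<tau> + t)/p, z)\<close>, which commutes with \<open>U\<close>.
  Unfolding \<open>V x\<^sub>j\<close> as a sum over \<open>\<Gamma>\<^sub>\<infinity>\<close>-orbits of integral matrices of determinant \<open>p\<close>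
  and sorting these orbits by the other one-sided coset decomposition gives
  \<open>V x\<^sub>j = x\<^bsub>j+1\<^esub> + p\<^bsup>1-k\<^esup> U x\<^bsub>j-1\<^esub>\<close> with \<open>x\<^bsub>-1\<^esub> = 0\<close>; for \<open>j = 0\<close> the second term is a sum over
  \<open>p\<close>-th roots of unity, which vanishes because \<open>p\<close> divides \<open>m\<close> and \<open>r\<close> but not \<open>n\<close>.

  If \<open>x\<^bsub>\<mu>-1\<^esub> = 0\<close>, this Chebyshev-like recursion is antisymmetric about \<open>\<mu> - 1\<close>, so
  \<open>x\<^bsub>2\<mu>\<^esub> = p\<^bsup>(1-k)\<mu>\<^esup> U\<^sup>\<mu> x\<^sub>0\<close>, and \<open>x\<^sub>0 \<noteq> 0\<close> since otherwise all \<open>x\<^sub>j\<close> vanish. For the last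
  series put \<open>N = p\<^sup>\<mu>\<close>. If the series of index \<open>N\<^sup>2m\<close> attached to \<open>(n, Nr)\<close> vanishes, then by the
  recursion so does the one of index \<open>N\<^sup>3m\<close> attached to \<open>(Nn, N\<^sup>2r)\<close>; replacing \<open>z\<close> by \<open>z/N\<close>
  and averaging over \<open>(\<int>/N)\<^bsup>2g\<^esup>\<close> turns the latter into \<open>x\<^sub>\<mu>\<close>.
\<close>

section \<open>The terms of the Poincar\'e series\<close>

text \<open>The integral matrix with rows \<open>(a, b)\<close> and \<open>(c, d)\<close>, kept as a
  tuple so that definitions can match on its entries.\<close>

type_synonym quad = "int \<times> int \<times> int \<times> int"

definition linform :: "int ^'g \<Rightarrow> 'a::comm_ring_1 ^'g \<Rightarrow> 'a" where
  "linform r x = (\<Sum>i\<in>UNIV. of_int (r $ i) * x $ i)"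

definition cmat :: "real ^'g ^'g \<Rightarrow> complex ^'g ^'g" where
  "cmat m = map_matrix complex_of_real m"

text \<open>At an integral vector \<open>l\<close> this is the coefficient of \<tau> after
  \<open>e(n\<tau> + rz)\<close> has been slashed by the translation \<open>(l, 0)\<close>.\<close>

definition qpoly :: "real ^'g ^'g \<Rightarrow> nat \<Rightarrow> int ^'g \<Rightarrow> complex ^'g \<Rightarrow> complex" where
  "qpoly m n r x = of_nat n + linform r x + qform (cmat m) x"

text \<open>The \<open>l\<close>-th summand of the theta series \<open>\<Sum>\<^sub>l e(Q(l)\<tau> + (r + 2lm)z)\<close>, with \<open>Q\<close> given by \<open>qpoly\<close>,
  after the index raising action of a matrix of determinant \<open>N\<close>; its index is \<open>Nm\<close>.\<close>

fun jterm :: "int \<Rightarrow> nat \<Rightarrow> real ^'g ^'g \<Rightarrow> nat \<Rightarrow> int ^'g \<Rightarrow> quad \<Rightarrow> int ^'g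
    \<Rightarrow> complex \<Rightarrow> complex ^'g \<Rightarrow> complex" where
  "jterm k N m n r (a, b, c, d) l \<tau> z =
     (of_int c * \<tau> + of_int d) powi (- k) *
     e ((qpoly m n r (of_int_vec l) * (of_int a * \<tau> + of_int b)
          - of_nat N * of_int c * qform (cmat m) z
          + of_nat N * (linform r z + 2 * bilin (cmat m) (of_int_vec l) z))
        / (of_int c * \<tau> + of_int d))"

lemma linform_add: "linform r (x + y) = linform r x + linform r y"
  by (simp add: linform_def algebra_simps sum.distrib)

lemma linform_scale: "linform r (s *s x) = s * linform r x"
  by (simp add: linform_def sum_distrib_left algebra_simps)

lemma linform_smult: "linform (t *s r) x = of_int t * linform r x"
  by (simp add: linform_def sum_distrib_left algebra_simps)

lemma linform_of_int_Ints: "linform r (of_int_vec l) \<in> (\<int> :: complex set)"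
  by (simp add: linform_def of_int_vec_def Ints_sum)

lemma bilin_cmat_scaleR: "bilin (cmat (s *\<^sub>R m)) x y = of_real s * bilin (cmat m) x y"
  by (simp add: bilin_def cmat_def sum_distrib_left algebra_simps)

lemma bilin_cmat_commute:
  assumes "transpose m = m"
  shows "bilin (cmat m) x y = bilin (cmat m) y x"
proof (rule bilin_commute)
  show "transpose (cmat m) = cmat m"
    using assms by (simp add: cmat_def transpose_def vec_eq_iff)
qed

lemma qform_add:
  assumes "transpose m = m"
  shows "qform (cmat m) (x + y) = qform (cmat m) x + 2 * bilin (cmat m) x y + qform (cmat m) y"
  by (simp add: qform_def bilin_add_left bilin_add_right bilin_cmat_commute[OF assms, of y x])

lemma qform_scale: "qform A (s *s x) = s\<^sup>2 * qform A x"
  by (simp add: qform_def bilin_scale_left bilin_scale_right power2_eq_square mult_ac)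

lemma qpoly_add:
  assumes "transpose m = m"
  shows "qpoly m n r (x + y) = qpoly m n r x + linform r y + 2 * bilin (cmat m) x y + qform (cmat m) y"
  by (simp add: qpoly_def qform_add[OF assms] linform_add)

text \<open>Stated for complex vectors, because it is used both for integral translations and, with
  \<open>z = 0\<close> and real \<open>x\<close>, \<open>y\<close>, to complete the square in the exponent of a term.\<close>

lemma heisenberg_shift_exponent:
  fixes a b c d \<tau> :: complex and x y z l :: "complex ^'g"
  assumes m: "transpose m = m" and det: "a * d - b * c = 1" and J: "c * \<tau> + d \<noteq> 0"
  defines "J \<equiv> c * \<tau> + d"
  defines "u \<equiv> a *s x + c *s y" and "v \<equiv> b *s x + d *s y"
  defines "w \<equiv> z + \<tau> *s u + v"
  shows "qform (cmat m) u * \<tau> + 2 * bilin (cmat m) u z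
      + (qpoly m n r l * (a * \<tau> + b) - c * qform (cmat m) w + (linform r w + 2 * bilin (cmat m) l w)) / J
    = (qpoly m n r (l + x) * (a * \<tau> + b) - c * qform (cmat m) z
        + (linform r z + 2 * bilin (cmat m) (l + x) z)) / J
      + (linform r y + 2 * bilin (cmat m) l y
         - a * b * qform (cmat m) x - 2 * b * c * bilin (cmat m) x y - c * d * qform (cmat m) y)"
proof -
  have J0: "J \<noteq> 0" using J by (simp add: J_def)
  define A where "A = a * \<tau> + b"
  let ?B = "bilin (cmat m)"
  \<comment> \<open>The determinant condition in terms of the numerator \<open>A\<close> and the
    denominator \<open>J\<close> of the Moebius image. As \<open>w = z + A x + J y\<close>, the
    identity multiplied by \<open>J\<close> can be compared coefficient by coefficient in the
    bilinear values.\<close>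
  have AJ: "a * J - c * A = 1" using det by (simp add: J_def A_def algebra_simps)
  have w: "w = z + A *s x + J *s y"
    by (simp add: w_def u_def v_def A_def J_def vec_eq_iff algebra_simps)
  note comm = bilin_cmat_commute[OF m]
  note ex = qform_def bilin_add_left bilin_add_right bilin_scale_left bilin_scale_right
     linform_add linform_scale
  have c1: "?B y x = ?B x y" "?B z x = ?B x z" "?B z y = ?B y z" by (rule comm)+
  have lhs1: "qform (cmat m) u = a^2 * ?B x x + 2 * a * c * ?B x y + c^2 * ?B y y"
    by (simp add: u_def ex c1 power2_eq_square algebra_simps)
  have lhs2: "?B u z = a * ?B x z + c * ?B y z"
    by (simp add: u_def ex)
  have lhs3: "qform (cmat m) w = ?B z z + A^2 * ?B x x + J^2 * ?B y y
      + 2 * A * ?B x z + 2 * J * ?B y z + 2 * A * J * ?B x y"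
    by (simp add: w ex c1 power2_eq_square algebra_simps)
  have lhs4: "?B l w = ?B l z + A * ?B l x + J * ?B l y"
    "linform r w = linform r z + A * linform r x + J * linform r y"
    by (simp_all add: w ex)
  have rhs: "qpoly m n r (l + x) = qpoly m n r l + linform r x + 2 * ?B l x + ?B x x"
    "?B (l + x) z = ?B l z + ?B x z"
    by (simp_all add: qpoly_add[OF m] ex) 
  have "(qform (cmat m) u * \<tau> + 2 * ?B u z) * J
      + (qpoly m n r l * A - c * qform (cmat m) w + (linform r w + 2 * ?B l w))
    = (qpoly m n r (l + x) * A - c * qform (cmat m) z
        + (linform r z + 2 * ?B (l + x) z))
      + (linform r y + 2 * ?B l y
         - a * b * qform (cmat m) x - 2 * b * c * ?B x y - c * d * qform (cmat m) y) * J"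
  proof -
    have s1: "a\<^sup>2 * \<tau> * J - c * A\<^sup>2 = A - a * b * J"
    proof -
      have "a\<^sup>2 * \<tau> * J - c * A\<^sup>2 = A * (a * J - c * A) - a * b * J"
        by (simp add: A_def power2_eq_square algebra_simps)
      thus ?thesis by (simp add: AJ)
    qed
    have s2: "a * c * \<tau> = c * A - b * c" "c\<^sup>2 * \<tau> = c * J - c * d"
      by (simp_all add: A_def J_def power2_eq_square algebra_simps)
    have "(qform (cmat m) u * \<tau> + 2 * ?B u z) * J
      + (qpoly m n r l * A - c * qform (cmat m) w + (linform r w + 2 * ?B l w))
      = (a\<^sup>2 * \<tau> * J - c * A\<^sup>2) * ?B x x + 2 * (a * c * \<tau> - c * A) * J * ?B x y
        + (c\<^sup>2 * \<tau> - c * J) * J * ?B y y + 2 * (a * J - c * A) * ?B x z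
        + (qpoly m n r l * A - c * ?B z z + (linform r z + 2 * ?B l z))
        + A * (linform r x + 2 * ?B l x) + J * (linform r y + 2 * ?B l y)"
      unfolding lhs1 lhs2 lhs3 lhs4 by (simp add: algebra_simps power2_eq_square)
    also have "\<dots> = (qpoly m n r (l + x) * A - c * qform (cmat m) z
        + (linform r z + 2 * ?B (l + x) z))
      + (linform r y + 2 * ?B l y
         - a * b * qform (cmat m) x - 2 * b * c * ?B x y - c * d * qform (cmat m) y) * J"
      unfolding s1 s2 AJ rhs by (simp add: qform_def algebra_simps)
    finally show ?thesis .
  qed
  thus ?thesis using J0 unfolding A_def by (simp add: field_simps)
qed

section \<open>Integrality of the quadratic form\<close>

text \<open>Off-diagonal terms come in equal pairs and the diagonal ones are even; the induction
  over the index set adds one row and column at a time.\<close>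

lemma even_integer_form:
  fixes M :: "int ^'g ^'g"
  assumes sym: "transpose M = M" and diag: "\<And>i. even (M $ i $ i)"
  shows "even (qform M x)"
proof -
  define E where "E = (\<lambda>i j. x $ i * M $ i $ j * x $ j)"
  have "M $ i $ j = M $ j $ i" for i j
    using sym by (metis transpose_def vec_lambda_beta)
  hence E_sym: "E i j = E j i" for i j by (simp add: E_def)
  have "even (\<Sum>i\<in>S. \<Sum>j\<in>S. E i j)" if "finite S" for S
    using that
  proof (induction S)
    case (insert t S)
    have "(\<Sum>i\<in>insert t S. \<Sum>j\<in>insert t S. E i j)
        = E t t + (\<Sum>j\<in>S. E t j) + ((\<Sum>i\<in>S. E i t) + (\<Sum>i\<in>S. \<Sum>j\<in>S. E i j))"
      using insert by (simp add: sum.distrib)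
    also have "(\<Sum>i\<in>S. E i t) = (\<Sum>j\<in>S. E t j)" by (simp add: E_sym)
    finally have *: "(\<Sum>i\<in>insert t S. \<Sum>j\<in>insert t S. E i j)
        = E t t + 2 * (\<Sum>j\<in>S. E t j) + (\<Sum>i\<in>S. \<Sum>j\<in>S. E i j)" by simp
    have "even (E t t)" using diag by (simp add: E_def)
    with insert.IH show ?case unfolding * by simp
  qed simp
  from this[of UNIV] show ?thesis by (simp add: E_def qform_def bilin_def)
qed

text \<open>With \<open>M = 2m\<close> the value is half of the even integer
  \<open>qform M l\<close>. If an odd \<open>p\<close> divides all entries of \<open>M\<close>, it
  divides \<open>2 * v\<close> and hence \<open>v\<close>.\<close>

lemma qform_of_int_vec:
  assumes "transpose m = m" "half_integral m"
  obtains v :: int where "qform (cmat m) (of_int_vec l) = of_int v"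
    and "\<And>p. odd p \<Longrightarrow> divides_entries p m \<Longrightarrow> int p dvd v"
proof -
  from assms(2) obtain M :: "int ^'a ^'a"
    where M: "\<And>i j. 2 * m $ i $ j = of_int (M $ i $ j)" "\<And>i. even (M $ i $ i)"
    unfolding half_integral_def by blast
  have "transpose M = M"
  proof -
    have "m $ i $ j = m $ j $ i" for i j
      using assms(1) by (metis transpose_def vec_lambda_beta)
    hence "real_of_int (M $ i $ j) = real_of_int (M $ j $ i)" for i j
      by (metis M(1))
    thus ?thesis by (simp add: transpose_def vec_eq_iff)
  qed
  then obtain v where v: "qform M l = 2 * v"
    using even_integer_form[OF _ M(2)] by (metis evenE)
  have "2 * qform (cmat m) (of_int_vec l)
      = (\<Sum>i\<in>UNIV. \<Sum>j\<in>UNIV. of_int (l $ i) * complex_of_real (2 * m $ i $ j) * of_int (l $ j))"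
    by (simp add: qform_def bilin_def of_int_vec_def cmat_def sum_distrib_left mult_ac)
  also have "\<dots> = of_int (qform M l)"
    unfolding M by (simp add: qform_def bilin_def)
  finally have 1: "qform (cmat m) (of_int_vec l) = of_int v" using v by simp
  have 2: "int p dvd v" if p: "odd p" "divides_entries p m" for p
  proof -
    have "int p dvd M $ i $ j" for i j
    proof -
      obtain c :: int where "2 * m $ i $ j = of_int (int p * c)"
        using p(2) unfolding divides_entries_def by blast
      with M(1)[of i j] have "M $ i $ j = int p * c" by linarith
      thus ?thesis by simp
    qed
    hence "int p dvd qform M l"
      unfolding qform_def bilin_def by (intro dvd_sum) simp
    hence "int p dvd 2 * v" by (simp add: v)
    moreover have "coprime (int p) 2" using p(1) by simp
    ultimately show ?thesis by (simp add: coprime_dvd_mult_right_iff)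
  qed
  from 1 2 show ?thesis by (rule that)
qed

lemma qpoly_Ints:
  assumes "transpose m = m" "half_integral m"
  shows "qpoly m n r (of_int_vec l) \<in> \<int>"
proof -
  obtain v where "qform (cmat m) (of_int_vec l) = of_int v"
    using qform_of_int_vec[OF assms] by blast
  thus ?thesis using linform_of_int_Ints[of r l] by (simp add: qpoly_def)
qed

lemma of_int_vec_add: "of_int_vec (x + y) = of_int_vec x + of_int_vec y"
  by (simp add: of_int_vec_def vec_eq_iff)

lemma of_int_vec_scale: "of_int_vec (s *s x) = of_int s *s of_int_vec x"
  by (simp add: of_int_vec_def vec_eq_iff)

lemma of_int_vec_0 [simp]: "of_int_vec 0 = 0"
  by (simp add: of_int_vec_def vec_eq_iff)

lemma automorphy_factor_nonzero:
  assumes "Im \<tau> > 0" "(c, d) \<noteq> (0, 0)"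
  shows "of_int c * \<tau> + of_int d \<noteq> 0"
proof
  assume eq: "of_int c * \<tau> + of_int d = 0"
  hence "Im (of_int c * \<tau> + of_int d) = 0" by simp
  hence "c = 0" using assms(1) by simp
  with eq assms(2) show False by simp
qed

text \<open>For integral \<open>x\<close> and \<open>y\<close> the constant left over in
  \<open>heisenberg_shift_exponent\<close> is an integer, so slashing by the translation
  \<open>(x, y)M\<close> only relabels the summand \<open>l\<close> as \<open>l + x\<close>.\<close>

lemma jterm_slash:
  assumes m: "transpose m = m" "half_integral m" and det: "a * d - b * c = 1" and \<tau>: "Im \<tau> > 0"
  shows "e (qform (cmat m) (of_int_vec (a *s x + c *s y)) * \<tau>
             + 2 * bilin (cmat m) (of_int_vec (a *s x + c *s y)) z)
      * jterm k 1 m n r (a, b, c, d) l \<tau>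
          (z + \<tau> *s of_int_vec (a *s x + c *s y) + of_int_vec (b *s x + d *s y))
    = jterm k 1 m n r (a, b, c, d) (l + x) \<tau> z"
proof -
  have "(c, d) \<noteq> (0, 0)" using det by auto
  note J0 = automorphy_factor_nonzero[OF \<tau> this]
  have det': "of_int a * of_int d - of_int b * of_int c = (1 :: complex)"
    by (metis det of_int_diff of_int_mult of_int_1)
  let ?x = "of_int_vec x :: complex ^'a" and ?y = "of_int_vec y :: complex ^'a"
    and ?l = "of_int_vec l :: complex ^'a"
  let ?K = "linform r ?y + 2 * bilin (cmat m) ?l ?y - of_int a * of_int b * qform (cmat m) ?x
      - 2 * of_int b * of_int c * bilin (cmat m) ?x ?y - of_int c * of_int d * qform (cmat m) ?y"
  have "?K \<in> \<int>"
  proof -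
    have q: "qform (cmat m) (of_int_vec v) \<in> \<int>" for v
      by (rule qform_of_int_vec[OF m, of v]) simp
    have B: "2 * bilin (cmat m) (of_int_vec v) (of_int_vec w) \<in> \<int>" for v w
      unfolding cmat_def by (rule two_bilin_Ints[OF m(2)])
    obtain i1 i2 i3 i4 i5 where i: "linform r ?y = of_int i1" "2 * bilin (cmat m) ?l ?y = of_int i2"
      "qform (cmat m) ?x = of_int i3" "2 * bilin (cmat m) ?x ?y = of_int i4"
      "qform (cmat m) ?y = of_int i5"
      using linform_of_int_Ints[of r y] B[of l y] q[of x] B[of x y] q[of y] unfolding Ints_def by blast
    have "?K = of_int (i1 + i2 - a * b * i3 - b * c * i4 - c * d * i5)"
      using i(4) by (simp add: i mult.left_commute[of 2])
    thus ?thesis by simp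
  qed
  hence eK: "e ?K = 1" by (rule e_Ints)
  show ?thesis
    unfolding jterm.simps of_int_vec_add of_int_vec_scale of_nat_1 mult_1
    apply (subst mult.left_commute)
    apply (subst e_add[symmetric])
    apply (subst heisenberg_shift_exponent[OF m(1) det' J0])
    apply (simp only: e_add eK mult_1_right)
    done
qed

text \<open>The exponent changes by the integer \<open>s\<close> times the value of
  \<open>qpoly\<close>. Hence a term depends only on the
  \<open>\<Gamma>\<^sub>\<infinity>\<close>-orbit of its matrix, whatever the determinant.\<close>

lemma jterm_translate:
  assumes m: "transpose m = m" "half_integral m" and cd: "(c, d) \<noteq> (0, 0)" and \<tau>: "Im \<tau> > 0"
  shows "jterm k N m n r (a + s * c, b + s * d, c, d) l \<tau> z = jterm k N m n r (a, b, c, d) l \<tau> z"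
proof -
  note J0 = automorphy_factor_nonzero[OF \<tau> cd]
  let ?q = "qpoly m n r (of_int_vec l)"
  have "?q * of_int s \<in> \<int>" by (intro Ints_mult qpoly_Ints[OF m] Ints_of_int)
  hence eq: "e (?q * of_int s) = 1" by (rule e_Ints)
  have "(?q * (of_int (a + s * c) * \<tau> + of_int (b + s * d)) - X + Y) / (of_int c * \<tau> + of_int d)
      = (?q * (of_int a * \<tau> + of_int b) - X + Y) / (of_int c * \<tau> + of_int d) + ?q * of_int s" for X Y
    using J0 by (simp add: field_simps)
  thus ?thesis by (simp only: jterm.simps e_add eq mult_1_right)
qed

section \<open>The terms under matrices of determinant p\<close>

text \<open>Right multiplication of the matrix by \<open>(p, 0, 0, 1)\<close>: this handles the
  first summand of the Hecke operator.\<close>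

lemma jterm_at_upper_left:
  assumes "p > 0"
  shows "jterm k 1 m n r (a, b, c, d) l (of_nat p * \<tau>) (of_nat p *s z)
     = jterm k p m n r (int p * a, b, int p * c, d) l \<tau> z"
  using assms
  by (simp add: qform_scale linform_scale bilin_scale_right power2_eq_square algebra_simps)

text \<open>Right multiplication by \<open>(1, t, 0, p)\<close>: this handles the remaining summands
  of the Hecke operator.\<close>

lemma jterm_at_lower_right:
  assumes p: "p > 0"
  shows "of_nat p powi (- k) * jterm k 1 m n r (a, b, c, d) l ((\<tau> + of_nat t) / of_nat p) z
     = jterm k p m n r (a, a * int t + int p * b, c, c * int t + int p * d) l \<tau> z"
proof -
  define J where "J = of_int c * ((\<tau> + of_nat t) / of_nat p) + of_int d"
  define A where "A = of_int a * ((\<tau> + of_nat t) / of_nat p) + of_int b"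
  have J': "of_int c * \<tau> + of_int (c * int t + int p * d) = of_nat p * J"
    and A': "of_int a * \<tau> + of_int (a * int t + int p * b) = of_nat p * A"
    using p by (simp_all add: J_def A_def field_simps)
  have "(Q * (of_nat p * A) - of_nat p * of_int c * X + of_nat p * Y) / (of_nat p * J)
      = (Q * A - of_nat 1 * of_int c * X + of_nat 1 * Y) / J" for Q X Y
  proof -
    have "Q * (of_nat p * A) - of_nat p * of_int c * X + of_nat p * Y
      = of_nat p * (Q * A - of_nat 1 * of_int c * X + of_nat 1 * Y)" by (simp add: algebra_simps)
    thus ?thesis using p by simp
  qed
  thus ?thesis
    unfolding jterm.simps J' A' J_def[symmetric] A_def[symmetric] power_int_mult_distrib
    by simp
qed

text \<open>Left multiplication by \<open>(1, t, 0, p)\<close>. The parameter \<open>t\<close>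
  survives only in one exponential factor, a p-th root of unity when \<open>qpoly\<close> is
  integral, so that summing over \<open>t\<close> becomes a character sum.\<close>

lemma jterm_lower_right:
  assumes p: "p > 0" and J: "of_int c * \<tau> + of_int d \<noteq> 0"
  shows "jterm k p m n r (a + int t * c, b + int t * d, int p * c, int p * d) l \<tau> z
    = of_nat p powi (- k) * e (qpoly m n r (of_int_vec l) * of_nat t / of_nat p) *
      ((of_int c * \<tau> + of_int d) powi (- k) *
      e ((qpoly m n r (of_int_vec l) / of_nat p * (of_int a * \<tau> + of_int b)
          - of_nat p * of_int c * qform (cmat m) z
          + (linform r z + 2 * bilin (cmat m) (of_int_vec l) z)) / (of_int c * \<tau> + of_int d)))"
proof -
  define J where "J = of_int c * \<tau> + of_int d"
  have J0: "J \<noteq> 0" using J by (simp add: J_def)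
  have J': "of_int (int p * c) * \<tau> + of_int (int p * d) = of_nat p * J"
    by (simp add: J_def algebra_simps)
  have A': "of_int (a + int t * c) * \<tau> + of_int (b + int t * d)
      = (of_int a * \<tau> + of_int b) + of_nat t * J"
    by (simp add: J_def algebra_simps)
  have "(Q * (A + of_nat t * J) - of_nat p * of_int (int p * c) * X + of_nat p * Y) / (of_nat p * J)
      = Q * of_nat t / of_nat p + (Q / of_nat p * A - of_nat p * of_int c * X + Y) / J"
    for Q A X Y
    using p J0 by (simp add: field_simps)
  note this[of "qpoly m n r (of_int_vec l)" "of_int a * \<tau> + of_int b" "qform (cmat m) z"
      "linform r z + 2 * bilin (cmat m) (of_int_vec l) z"]
  thus ?thesis
    unfolding jterm.simps J' A' J_def[symmetric] power_int_mult_distrib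
    by (simp only: e_add mult_ac)
qed

text \<open>Left multiplication by \<open>(p, 0, 0, 1)\<close> multiplies the whole polynomial by
  \<open>p\<close>, which gives a term of the next series in the sequence.\<close>

lemma jterm_upper_left:
  "jterm k p m n r (int p * a, int p * b, c, d) l \<tau> z
    = jterm k 1 (real p *\<^sub>R m) (p * n) (int p *s r) (a, b, c, d) l \<tau> z"
  by (simp add: qpoly_def qform_def bilin_cmat_scaleR linform_smult algebra_simps)

text \<open>Dividing \<open>z\<close> by \<open>N\<close> embeds the series of index
  \<open>N^2 m\<close> into that of index \<open>m\<close> as the part with summation vector in
  \<open>N\<close> times the lattice.\<close>

lemma jterm_scaled:
  assumes "p > 0" "N > 0"
  shows "jterm k 1 (real N ^ 2 *\<^sub>R m) n (int N *s r) M l \<tau> (of_real (1 / real N) *s z)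
    = jterm k 1 m n r M (int N *s l) \<tau> z"
  using assms by (cases M) 
    (simp add: qpoly_def qform_def bilin_cmat_scaleR linform_smult linform_scale of_int_vec_scale
      bilin_scale_left bilin_scale_right power2_eq_square field_simps)

section \<open>Summation over coset representatives\<close>

text \<open>One matrix for each coprime bottom row \<open>(c, d)\<close>, that is, for each coset in \<open>\<Gamma>\<^sub>\<infinity> \ SL\<^sub>2(\<int>)\<close>.\<close>

definition sl2_reps :: "quad set" where
  "sl2_reps = {(a, b, c, d). a * d - b * c = 1 \<and> (a, b) = (SOME (x, y). x * d - y * c = 1)}"

lemma sl2_reps_det: "(a, b, c, d) \<in> sl2_reps \<Longrightarrow> a * d - b * c = 1"
  by (simp add: sl2_reps_def)

lemma sl2_reps_unique:
  "(a, b, c, d) \<in> sl2_reps \<Longrightarrow> (a', b', c, d) \<in> sl2_reps \<Longrightarrow> a' = a \<and> b' = b"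
  unfolding sl2_reps_def mem_Collect_eq case_prod_conv by (metis Pair_inject)

lemma sl2_reps_exists:
  assumes det: "a * d - b * c = (1 :: int)"
  shows "\<exists>s. (a + s * c, b + s * d, c, d) \<in> sl2_reps"
proof -
  obtain x y where xy: "(x, y) = (SOME (x, y). x * d - y * c = 1)"
    by (metis surj_pair)
  have "\<exists>p. case p of (x, y) \<Rightarrow> x * d - y * c = 1" using det by (intro exI[of _ "(a, b)"]) simp
  hence "case (SOME (x, y). x * d - y * c = 1) of (x, y) \<Rightarrow> x * d - y * c = 1"
    by (rule someI_ex)
  hence xy1: "x * d - y * c = 1" unfolding xy[symmetric] by simp
  \<comment> \<open>Two top rows completing the same bottom row differ by a multiple of it; the
    multiplier is the determinant of the two top rows.\<close>
  have "a + (a * y - b * x) * c = x" "b + (a * y - b * x) * d = y"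
    using det xy1 by algebra+
  moreover have "(x, y, c, d) \<in> sl2_reps" using xy xy1 by (simp add: sl2_reps_def)
  ultimately show ?thesis by metis
qed

lemma sl2_reps_bottom_nonzero: "(a, b, c, d) \<in> sl2_reps \<Longrightarrow> (c, d) \<noteq> (0, 0)"
  by (auto dest: sl2_reps_det)

section \<open>Cosets in the Jacobi group\<close>

definition mat2 :: "int \<Rightarrow> int \<Rightarrow> int \<Rightarrow> int \<Rightarrow> int ^2 ^2" where
  "mat2 a b c d = vector [vector [a, b], vector [c, d]]"

lemma mat2_nth [simp]: "mat2 a b c d $ 1 $ 1 = a" "mat2 a b c d $ 1 $ 2 = b"
    "mat2 a b c d $ 2 $ 1 = c" "mat2 a b c d $ 2 $ 2 = d"
  by (simp_all add: mat2_def vector_2)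

lemma mat2_eta: "M = mat2 (M $ 1 $ 1) (M $ 1 $ 2) (M $ 2 $ 1) (M $ 2 $ 2)"
  by (simp add: vec_eq_iff forall_2)

text \<open>This is the product of the translation \<open>(1, (l, 0))\<close> with
  \<open>(M, (0, 0))\<close>, in this order.\<close>

fun jacobi_rep :: "quad \<times> (int ^'g) \<Rightarrow> 'g::finite jacobi_elem" where
  "jacobi_rep ((a, b, c, d), l) = (mat2 a b c d, (a *s l, b *s l))"

lemma jacobi_rep_carrier:
  assumes "M \<in> sl2_reps" shows "jacobi_rep (M, l) \<in> carrier jacobi_group"
proof -
  obtain a b c d where M: "M = (a, b, c, d)" by (cases M)
  show ?thesis using sl2_reps_det[of a b c d] assms
    by (simp add: M jacobi_group_def det_2)
qed

lemma jacobi_inf_coset_rep: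
  fixes l :: "int ^'g::finite"
  shows "jacobi_inf #>\<^bsub>jacobi_group\<^esub> jacobi_rep ((a, b, c, d), l) =
     range (\<lambda>(s, v). (mat2 (a + s * c) (b + s * d) c d, (a *s l + c *s v, b *s l + d *s v)))"
proof -
  have mult: "(mat2 1 s 0 1, (0, v)) \<otimes>\<^bsub>jacobi_group\<^esub> jacobi_rep ((a, b, c, d), l)
      = (mat2 (a + s * c) (b + s * d) c d, (a *s l + c *s v, b *s l + d *s v))" for s v
    by (simp add: jacobi_group_def vec_eq_iff forall_2 matrix_matrix_mult_def sum_2)
  have inf: "jacobi_inf = range (\<lambda>(s, v :: int ^'g). (mat2 1 s 0 1, (0, v)))"
    by (auto simp: jacobi_inf_def mat2_def image_iff)
  show ?thesis
    unfolding r_coset_def inf UNION_singleton_eq_range image_image case_prod_beta mult ..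
qed

text \<open>A coset fixes the bottom row, hence the representative \<open>M\<close>. Writing the
  translation part as \<open>(l, v)M\<close>, the subgroup changes \<open>v\<close> freely and
  leaves \<open>l\<close> alone.\<close>

lemma bij_betw_jacobi_reps:
  "bij_betw (\<lambda>x. jacobi_inf #>\<^bsub>jacobi_group\<^esub> jacobi_rep x)
     (sl2_reps \<times> (UNIV :: (int ^'g) set)) (rcosets\<^bsub>jacobi_group\<^esub> (jacobi_inf :: 'g::finite jacobi_elem set))"
proof -
  interpret group "jacobi_group :: 'g jacobi_elem monoid" by (rule group_jacobi_group)
  note H = subgroup_jacobi_inf[where ?'g = 'g]
  have "inj_on (\<lambda>x. jacobi_inf #>\<^bsub>jacobi_group\<^esub> jacobi_rep x) (sl2_reps \<times> (UNIV :: (int ^'g) set))"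
  proof (rule inj_onI)
    fix X X' :: "quad \<times> (int ^'g)"
    assume X: "X \<in> sl2_reps \<times> UNIV" and X': "X' \<in> sl2_reps \<times> UNIV"
      and eq: "jacobi_inf #>\<^bsub>jacobi_group\<^esub> jacobi_rep X = jacobi_inf #>\<^bsub>jacobi_group\<^esub> jacobi_rep X'"
    obtain a b c d l where Xe: "X = ((a, b, c, d), l)" by (cases X) auto
    obtain a' b' c' d' l' where Xe': "X' = ((a', b', c', d'), l')" by (cases X') auto
    have "jacobi_rep X' \<in> jacobi_inf #>\<^bsub>jacobi_group\<^esub> jacobi_rep X'"
      using X' by (intro rcos_self H) (auto simp: jacobi_rep_carrier simp del: jacobi_rep.simps)
    then obtain s v where *: "mat2 a' b' c' d' = mat2 (a + s * c) (b + s * d) c d"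
        "a' *s l' = a *s l + c *s v" "b' *s l' = b *s l + d *s v"
      unfolding eq[symmetric] Xe jacobi_inf_coset_rep by (auto simp: Xe')
    have cd: "c' = c" "d' = d" using *(1) by (metis mat2_nth)+
    with X X' have ab: "a' = a" "b' = b"
      using sl2_reps_unique[of a b c d a' b'] by (auto simp: Xe Xe')
    have det: "a * d - b * c = 1" using X sl2_reps_det by (simp add: Xe)
    have "l' $ i = l $ i" for i
    proof -
      have "a * l' $ i = a * l $ i + c * v $ i" "b * l' $ i = b * l $ i + d * v $ i"
        using *(2,3) by (simp_all add: ab vec_eq_iff)
      thus ?thesis using det by algebra
    qed
    thus "X = X'" by (simp add: Xe Xe' ab cd vec_eq_iff)
  qed
  moreover have "(\<lambda>x. jacobi_inf #>\<^bsub>jacobi_group\<^esub> jacobi_rep x) ` (sl2_reps \<times> (UNIV :: (int ^'g) set))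
      = rcosets\<^bsub>jacobi_group\<^esub> jacobi_inf" (is "?L = ?R")
  proof
    show "?L \<subseteq> ?R"
      by (auto simp: RCOSETS_def intro!: bexI jacobi_rep_carrier)
    show "?R \<subseteq> ?L"
    proof
      fix C :: "'g jacobi_elem set"
      assume "C \<in> ?R"
      then obtain g :: "'g jacobi_elem" where g: "g \<in> carrier jacobi_group"
          "C = jacobi_inf #>\<^bsub>jacobi_group\<^esub> g"
        by (auto simp: RCOSETS_def)
      obtain M x y where ge: "g = (M, (x, y))" by (cases g) auto
      define a b c d where "a = M $ 1 $ 1" "b = M $ 1 $ 2" "c = M $ 2 $ 1" "d = M $ 2 $ 2"
      note abcd = this
      have M: "M = mat2 a b c d" unfolding abcd by (rule mat2_eta)
      have det: "a * d - b * c = 1"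
        using g(1) by (simp add: ge jacobi_group_def det_2 abcd)
      from sl2_reps_exists[OF this] obtain s where s: "(a + s * c, b + s * d, c, d) \<in> sl2_reps" by blast
      define a' b' where "a' = a + s * c" "b' = b + s * d"
      note ab' = this
      have det': "a' * d - b' * c = 1" using det by (simp add: ab' algebra_simps)
      \<comment> \<open>\<open>(l, v)\<close> is \<open>(x, y)\<close> times the inverse of the
        chosen representative.\<close>
      define l where "l = d *s x - c *s y"
      define v where "v = a' *s y - b' *s x"
      have xy: "a' * (d * X - c * Y) + c * (a' * Y - b' * X) = X"
           "b' * (d * X - c * Y) + d * (a' * Y - b' * X) = Y" for X Y
        using det' by algebra+
      have x: "x = a' *s l + c *s v" "y = b' *s l + d *s v"
        by (simp_all only: vec_eq_iff l_def v_def vector_add_component vector_minus_component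
              vector_smult_component xy simp_thms)
      have Me: "M = mat2 (a' + (- s) * c) (b' + (- s) * d) c d"
        by (simp add: M ab')
      have "g \<in> jacobi_inf #>\<^bsub>jacobi_group\<^esub> jacobi_rep ((a', b', c, d), l)"
        unfolding jacobi_inf_coset_rep ge Me using x by (intro image_eqI[of _ _ "(- s, v)"]) simp_all
      hence "C = jacobi_inf #>\<^bsub>jacobi_group\<^esub> jacobi_rep ((a', b', c, d), l)"
        unfolding g(2) by (intro repr_independence[symmetric] jacobi_rep_carrier H) (use s ab' in auto)
      thus "C \<in> ?L" using s by (intro image_eqI[of _ _ "((a', b', c, d), l)"]) (auto simp: ab')
    qed
  qed
  ultimately show ?thesis by (simp add: bij_betw_def)
qed

text \<open>The term with \<open>l = 0\<close> is the exponential slashed by the matrix alone, and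
  \<open>jterm_slash\<close> then moves the summation vector from \<open>0\<close> to
  \<open>l\<close>.\<close>

lemma jacobi_slash_jacobi_rep:
  fixes m :: "real ^'g ^'g"
  assumes m: "transpose m = m" "half_integral m" and M: "M \<in> sl2_reps" and \<tau>: "Im \<tau> > 0"
  shows "jacobi_slash k m (jacobi_exp n r) (jacobi_rep (M, l)) \<tau> z = jterm k 1 m n r M l \<tau> z"
proof -
  obtain a b c d where Me: "M = (a, b, c, d)" by (cases M)
  have det: "a * d - b * c = 1" using M sl2_reps_det by (simp add: Me)
  define J where "J = of_int c * \<tau> + of_int d"
  have J0: "J \<noteq> 0"
    unfolding J_def using M by (intro automorphy_factor_nonzero \<tau> sl2_reps_bottom_nonzero) (simp add: Me)
  define w where "w = z + \<tau> *s of_int_vec (a *s l) + of_int_vec (b *s l)"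
  have "jterm k 1 m n r M l \<tau> z = jterm k 1 m n r (a, b, c, d) (0 + l) \<tau> z"
    by (simp add: Me)
  also have "\<dots> = e (qform (cmat m) (of_int_vec (a *s l)) * \<tau>
             + 2 * bilin (cmat m) (of_int_vec (a *s l)) z)
      * jterm k 1 m n r (a, b, c, d) 0 \<tau> w"
    using jterm_slash[OF m det \<tau>, where l = 0 and x = l and y = 0]
    by (simp add: w_def del: jterm.simps)
  also have "jterm k 1 m n r (a, b, c, d) 0 \<tau> w = J powi (- k) *
      e (- of_int c / J * qform (cmat m) w)
      * jacobi_exp n r ((of_int a * \<tau> + of_int b) / J) ((1 / J) *s w)"
  proof -
    have "qpoly m n r 0 = of_nat n" "bilin (cmat m) 0 w = 0"
      by (simp_all add: qpoly_def linform_def qform_def bilin_def)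
    moreover have "jacobi_exp n r x y = e (of_nat n * x + linform r y)" for x y
      by (simp add: jacobi_exp_def linform_def)
    moreover have "(of_nat n * A - of_int c * Q + L) / J
        = - of_int c / J * Q + (of_nat n * (A / J) + 1 / J * L)" for A Q L
      using J0 by (simp add: field_simps)
    ultimately show ?thesis
      unfolding jterm.simps J_def[symmetric] of_int_vec_0 of_nat_1 mult_1
      by (simp only: e_add linform_scale mult_zero_right add_0_right mult.assoc)
  qed
  finally have "jterm k 1 m n r M l \<tau> z = J powi (- k) *
      (e (- of_int c / J * qform (cmat m) w) *
       (e (qform (cmat m) (of_int_vec (a *s l)) * \<tau>) * e (2 * bilin (cmat m) (of_int_vec (a *s l)) z)))
      * jacobi_exp n r ((of_int a * \<tau> + of_int b) / J) ((1 / J) *s w)"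
    by (simp only: e_add mult_ac)
  thus ?thesis
    by (simp only: Me jacobi_rep.simps jacobi_slash.simps Let_def mat2_nth J_def w_def cmat_def e_add mult.assoc)
qed

text \<open>A summand takes the same value at every element of its coset, so the element picked by
  \<open>SOME\<close> may be replaced by \<open>jacobi_rep\<close>.\<close>

theorem jacobi_poincare_eq:
  fixes m :: "real ^'g ^'g"
  assumes m: "transpose m = m" "half_integral m" and \<tau>: "Im \<tau> > 0"
  shows "jacobi_poincare k m n r \<tau> z
    = (\<Sum>\<^sub>\<infinity>(M, l)\<in>sl2_reps \<times> UNIV. jterm k 1 m n r M l \<tau> z)"
proof -
  interpret group "jacobi_group :: 'g jacobi_elem monoid" by (rule group_jacobi_group)
  have "jacobi_poincare k m n r \<tau> z = (\<Sum>\<^sub>\<infinity>x\<in>sl2_reps \<times> UNIV.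
      jacobi_slash k m (jacobi_exp n r) (SOME \<gamma>. \<gamma> \<in> jacobi_inf #>\<^bsub>jacobi_group\<^esub> jacobi_rep x) \<tau> z)"
    unfolding jacobi_poincare_def
    by (rule infsum_reindex_bij_betw[OF bij_betw_jacobi_reps, symmetric])
  also have "\<dots> = (\<Sum>\<^sub>\<infinity>(M, l)\<in>sl2_reps \<times> UNIV. jterm k 1 m n r M l \<tau> z)"
  proof (rule infsum_cong, clarify)
    fix a b c d and l :: "int ^'g"
    assume M: "(a, b, c, d) \<in> sl2_reps"
    let ?\<gamma> = "jacobi_rep ((a, b, c, d), l)"
    have car: "?\<gamma> \<in> carrier jacobi_group" using M by (rule jacobi_rep_carrier)
    have "?\<gamma> \<in> jacobi_inf #>\<^bsub>jacobi_group\<^esub> ?\<gamma>"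
      by (intro rcos_self car subgroup_jacobi_inf)
    hence "(SOME \<gamma>. \<gamma> \<in> jacobi_inf #>\<^bsub>jacobi_group\<^esub> ?\<gamma>) \<in> jacobi_inf #>\<^bsub>jacobi_group\<^esub> ?\<gamma>"
      by (rule someI)
    then obtain \<delta> where "\<delta> \<in> jacobi_inf"
      "(SOME \<gamma>. \<gamma> \<in> jacobi_inf #>\<^bsub>jacobi_group\<^esub> ?\<gamma>) = \<delta> \<otimes>\<^bsub>jacobi_group\<^esub> ?\<gamma>"
      by (auto simp: r_coset_def)
    thus "jacobi_slash k m (jacobi_exp n r) (SOME \<gamma>. \<gamma> \<in> jacobi_inf #>\<^bsub>jacobi_group\<^esub> ?\<gamma>) \<tau> z
        = jterm k 1 m n r (a, b, c, d) l \<tau> z"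
      using jacobi_slash_jacobi_exp_coset[OF m car _ \<tau>] jacobi_slash_jacobi_rep[OF m M \<tau>] by metis
  qed
  finally show ?thesis .
qed

section \<open>Absolute convergence\<close>

lemma summable_on_prod_mult:
  fixes f :: "'a \<Rightarrow> real" and g :: "'b \<Rightarrow> real"
  assumes "f summable_on A" "g summable_on B" "\<And>x. x \<in> A \<Longrightarrow> f x \<ge> 0" "\<And>y. y \<in> B \<Longrightarrow> g y \<ge> 0"
  shows "(\<lambda>(x, y). f x * g y) summable_on A \<times> B"
proof (rule summable_on_SigmaI)
  show "((\<lambda>y. case (x, y) of (x, y) \<Rightarrow> f x * g y) has_sum f x * infsum g B) B" for x
    using assms(2) by (simp add: has_sum_cmult_right)
  show "(\<lambda>x. f x * infsum g B) summable_on A"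
    using assms(1) by (rule summable_on_cmult_left)
qed (use assms in auto)

text \<open>Any finite set of vectors lies in a box, and over a box the sum of products factors into
  a product of one-dimensional sums.\<close>

lemma summable_on_vec_prod:
  fixes f :: "'a \<Rightarrow> real"
  assumes f: "f summable_on UNIV" and nonneg: "\<And>x. f x \<ge> 0"
  shows "(\<lambda>v :: 'a ^'g. \<Prod>i\<in>UNIV. f (v $ i)) summable_on UNIV"
proof (rule nonneg_bdd_above_summable_on)
  show "bdd_above (sum (\<lambda>v :: 'a ^'g. \<Prod>i\<in>UNIV. f (v $ i)) ` {F. F \<subseteq> UNIV \<and> finite F})"
  proof (rule bdd_aboveI2)
    fix F :: "('a ^'g) set" assume "F \<in> {F. F \<subseteq> UNIV \<and> finite F}"
    hence F: "finite F" by simp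
    define S where "S = (\<Union>i. (\<lambda>v. v $ i) ` F)"
    have S: "finite S" unfolding S_def using F by simp
    have inj: "inj_on vec_nth F" by (auto simp: inj_on_def vec_nth_inject)
    have "(\<Sum>v\<in>F. \<Prod>i\<in>UNIV. f (v $ i)) = (\<Sum>h\<in>vec_nth ` F. \<Prod>i\<in>UNIV. f (h i))"
      by (simp add: sum.reindex[OF inj])
    also have "\<dots> \<le> (\<Sum>h\<in>PiE UNIV (\<lambda>_. S). \<Prod>i\<in>(UNIV :: 'g set). f (h i))"
    proof (rule sum_mono2)
      show "finite (PiE (UNIV :: 'g set) (\<lambda>_. S))" using S by (intro finite_PiE) auto
      show "vec_nth ` F \<subseteq> PiE UNIV (\<lambda>_. S)" by (auto simp: S_def)
    qed (auto intro: prod_nonneg nonneg)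
    also have "\<dots> = (\<Prod>i\<in>(UNIV :: 'g set). sum f S)"
      using S by (intro prod_sum_PiE[symmetric]) auto
    also have "\<dots> \<le> (\<Prod>i\<in>(UNIV :: 'g set). infsum f UNIV)"
      using S by (intro prod_mono conjI sum_nonneg nonneg finite_sum_le_infsum f) auto
    finally show "(\<Sum>v\<in>F. \<Prod>i\<in>UNIV. f (v $ i)) \<le> (\<Prod>i\<in>(UNIV :: 'g set). infsum f UNIV)" .
  qed
qed (auto intro: prod_nonneg nonneg)

definition decay :: "real \<Rightarrow> real \<Rightarrow> real" where
  "decay t x = (1 + x\<^sup>2) powr (- t)"

lemma decay_nonneg: "decay t x \<ge> 0"
  by (simp add: decay_def)

lemma summable_on_decay_int:
  assumes "t > 1/2"
  shows "(\<lambda>i::int. decay t (of_int i)) summable_on UNIV"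
proof -
  have "summable (\<lambda>n. decay t (of_nat n))"
  proof (rule summable_comparison_test_ev)
    show "summable (\<lambda>n. of_nat n powr (- (2 * t)) :: real)"
      using assms by (subst summable_real_powr_iff) simp
    show "\<forall>\<^sub>F n in sequentially. norm (decay t (of_nat n)) \<le> of_nat n powr (- (2 * t))"
    proof (rule eventually_sequentiallyI[of 1])
      fix n :: nat assume n: "1 \<le> n"
      have "decay t (real n) \<le> ((real n)\<^sup>2) powr (- t)"
        unfolding decay_def using n assms by (intro powr_mono2') auto
      also have "\<dots> = real n powr (- (2 * t))"
        using n by (simp add: powr_powr flip: powr_numeral)
      finally show "norm (decay t (of_nat n)) \<le> of_nat n powr (- (2 * t))"
        by (simp add: decay_nonneg)
    qed
  qed
  hence nat: "(\<lambda>n::nat. decay t (of_nat n)) summable_on UNIV"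
    by (subst summable_on_UNIV_nonneg_real_iff) (auto simp: decay_nonneg)
  have "(\<lambda>i::int. decay t (of_int i)) summable_on range int"
    using nat by (subst summable_on_reindex) (auto simp: o_def)
  moreover have "(\<lambda>i::int. decay t (of_int i)) summable_on range (\<lambda>n. - int n)"
    using nat by (subst summable_on_reindex) (auto simp: o_def inj_on_def decay_def)
  ultimately have "(\<lambda>i::int. decay t (of_int i)) summable_on (range int \<union> range (\<lambda>n. - int n))"
    by (rule summable_on_union)
  also have "range int \<union> range (\<lambda>n. - int n) = UNIV"
  proof -
    have "x \<in> range int \<union> range (\<lambda>n. - int n)" for x
      by (cases x rule: int_cases2) auto
    thus ?thesis by blast
  qed
  finally show ?thesis .
qed

text \<open>Replaces a real shift by an integral one at a cost uniform in \<open>x\<close>. For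
  \<open>0 \<le> f \<le> 1\<close>, \<open>j^2 \<le> 2(j+f)^2 + 2f^2\<close> gives
  \<open>1 + j^2 \<le> 3(1 + (j+f)^2)\<close>, whence the constant 3.\<close>

lemma decay_floor_shift:
  assumes "t \<ge> 0"
  shows "decay t (of_int l + x) \<le> 3 powr t * decay t (of_int (l + \<lfloor>x\<rfloor>))"
proof -
  define j where "j = real_of_int (l + \<lfloor>x\<rfloor>)"
  define f where "f = x - of_int \<lfloor>x\<rfloor>"
  have f: "0 \<le> f" "f \<le> 1" unfolding f_def by linarith+
  have lx: "of_int l + x = j + f" by (simp add: j_def f_def)
  have "f\<^sup>2 \<le> 1" using f by (simp add: power_le_one)
  moreover have "j\<^sup>2 + (j + 2 * f)\<^sup>2 = 2 * (j + f)\<^sup>2 + 2 * f\<^sup>2"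
    by (simp add: power2_eq_square algebra_simps)
  hence "j\<^sup>2 \<le> 2 * (j + f)\<^sup>2 + 2 * f\<^sup>2" by (smt (verit) zero_le_power2)
  moreover have "(1 + j\<^sup>2) / 3 \<le> 1 + w" if "f\<^sup>2 \<le> 1" "j\<^sup>2 \<le> 2 * w + 2 * f\<^sup>2" "w \<ge> 0" for w
    using that by (simp add: field_simps)
  ultimately have "(1 + j\<^sup>2) / 3 \<le> 1 + (j + f)\<^sup>2" using zero_le_power2 by blast
  hence "decay t (j + f) \<le> ((1 + j\<^sup>2) / 3) powr (- t)"
    unfolding decay_def using assms by (intro powr_mono2') (auto intro: add_pos_nonneg)
  also have "\<dots> = 3 powr t * decay t j"
    by (simp add: decay_def powr_divide powr_minus_divide)
  finally show ?thesis by (simp only: lx j_def)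
qed

text \<open>The inequality \<open>v \<le> exp v\<close> at \<open>v = u / s\<close>, raised to the
  power \<open>s\<close> and inverted.\<close>

lemma exp_minus_le_powr:
  fixes u s :: real
  assumes "u > 0" "s > 0"
  shows "exp (- u) \<le> (u / s) powr (- s)"
proof -
  have "(u / s) powr s \<le> exp (u / s) powr s"
    using assms by (intro powr_mono2) (auto intro: order_trans[OF _ exp_ge_add_one_self])
  also have "\<dots> = exp u" using assms by (simp add: exp_powr_real)
  finally have "1 / exp u \<le> 1 / (u / s) powr s"
    using assms by (intro divide_left_mono) auto
  thus ?thesis by (simp add: exp_minus powr_minus divide_inverse)
qed

text \<open>The exponent is shared equally among the coordinates, none of which exceeds the norm in
  absolute value.\<close>

lemma norm_decay_le_prod:
  fixes v :: "real ^'g"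
  assumes "t \<ge> 0"
  shows "(1 + (norm v)\<^sup>2) powr (- (real CARD('g) * t)) \<le> (\<Prod>i\<in>UNIV. decay t (v $ i))"
proof -
  have "(1 + (norm v)\<^sup>2) powr (- (real CARD('g) * t)) = (\<Prod>i\<in>(UNIV::'g set). (1 + (norm v)\<^sup>2) powr (- t))"
  proof -
    have "1 + (norm v)\<^sup>2 \<noteq> 0" by (smt (verit) zero_le_power2)
    thus ?thesis by (simp add: powr_power mult.commute)
  qed
  also have "\<dots> \<le> (\<Prod>i\<in>UNIV. decay t (v $ i))"
  proof (intro prod_mono conjI)
    fix i
    have "(v $ i)\<^sup>2 \<le> (norm v)\<^sup>2"
      using component_le_norm_cart[of v i] by (metis abs_le_square_iff abs_norm_cancel)
    thus "(1 + (norm v)\<^sup>2) powr (- t) \<le> decay t (v $ i)"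
      unfolding decay_def using assms by (intro powr_mono2') (auto intro: add_pos_nonneg)
  qed auto
  finally show ?thesis .
qed

text \<open>Both \<bar>c\<bar> and \<bar>d\<bar> are bounded by multiples of the norm of
  \<open>c\<tau> + d\<close>. The product form on the left, obtained from the inequality of
  arithmetic and geometric means and \<open>c^2 + d^2 \<ge> 1\<close>, lets the sum over
  \<open>(c, d)\<close> split into two one-dimensional sums.\<close>

lemma automorphy_factor_bound:
  assumes "Im \<tau> > 0"
  obtains K where "K > 0"
    "\<And>c d. (c, d) \<noteq> (0, 0 :: int) \<Longrightarrow>
       sqrt ((1 + (real_of_int c)\<^sup>2) * (1 + (real_of_int d)\<^sup>2)) \<le> K * (norm (of_int c * \<tau> + of_int d))\<^sup>2"
proof -
  define y where "y = Im \<tau>"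
  define t where "t = norm \<tau>"
  have y: "y > 0" using assms by (simp add: y_def)
  define K where "K = 2 * (1 / y\<^sup>2 + (1 + t / y)\<^sup>2)"
  have "K > 0" unfolding K_def using y by (intro mult_pos_pos add_pos_nonneg) auto
  moreover have "sqrt ((1 + (real_of_int c)\<^sup>2) * (1 + (real_of_int d)\<^sup>2))
      \<le> K * (norm (of_int c * \<tau> + of_int d))\<^sup>2" if "(c, d) \<noteq> (0, 0)" for c d :: int
  proof -
    define J where "J = of_int c * \<tau> + of_int d"
    have "Im J = of_int c * y" by (simp add: J_def y_def)
    hence "\<bar>of_int c\<bar> * y \<le> norm J" using abs_Im_le_cmod[of J] y by (simp add: abs_mult)
    hence c: "\<bar>of_int c\<bar> \<le> norm J / y" using y by (simp add: field_simps)
    have "norm (of_int d :: complex) = norm (J - of_int c * \<tau>)" by (simp add: J_def)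
    also have "\<dots> \<le> norm J + \<bar>of_int c\<bar> * t"
      using norm_triangle_ineq4[of J "of_int c * \<tau>"] by (simp add: norm_mult t_def)
    also have "\<dots> \<le> norm J + norm J / y * t"
      using c by (intro add_left_mono mult_right_mono) (auto simp: t_def)
    finally have d: "\<bar>of_int d\<bar> \<le> norm J * (1 + t / y)" by (simp add: algebra_simps)
    have c2: "(real_of_int c)\<^sup>2 \<le> (norm J / y)\<^sup>2"
      using c by (metis abs_ge_zero power2_abs power_mono)
    have d2: "(real_of_int d)\<^sup>2 \<le> (norm J * (1 + t / y))\<^sup>2"
      using d by (metis abs_ge_zero power2_abs power_mono)
    have "1 \<le> c\<^sup>2 + d\<^sup>2" using that
      by (smt (verit) power2_eq_iff_nonneg prod.inject sum_power2_gt_zero_iff zero_le_power2)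
    hence "1 \<le> (real_of_int c)\<^sup>2 + (real_of_int d)\<^sup>2"
      by (metis of_int_1_le_iff of_int_add of_int_power)
    moreover have "sqrt ((1 + (real_of_int c)\<^sup>2) * (1 + (real_of_int d)\<^sup>2))
        \<le> ((1 + (real_of_int c)\<^sup>2) + (1 + (real_of_int d)\<^sup>2)) / 2"
      by (rule arith_geo_mean_sqrt) auto
    ultimately have "sqrt ((1 + (real_of_int c)\<^sup>2) * (1 + (real_of_int d)\<^sup>2))
        \<le> 2 * ((real_of_int c)\<^sup>2 + (real_of_int d)\<^sup>2)" by (simp add: field_simps)
    also have "\<dots> \<le> 2 * ((norm J / y)\<^sup>2 + (norm J * (1 + t / y))\<^sup>2)"
      using c2 d2 by simp
    also have "\<dots> = K * (norm J)\<^sup>2"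
    proof -
      have "2 * ((N / y)\<^sup>2 + N\<^sup>2 * Q) = 2 * (1 / y\<^sup>2 + Q) * N\<^sup>2" for N Q
        by (simp add: power_divide algebra_simps)
      thus ?thesis by (simp only: K_def power_mult_distrib)
    qed
    finally show ?thesis by (simp add: J_def)
  qed
  ultimately show ?thesis by (rule that)
qed

section \<open>Coercivity from the discriminant condition\<close>

definition coercive :: "real ^'g ^'g \<Rightarrow> nat \<Rightarrow> int ^'g \<Rightarrow> bool" where
  "coercive m n r \<longleftrightarrow>
     (\<exists>\<delta>>0. \<forall>x. \<delta> * (1 + (norm x)\<^sup>2) \<le> real n + linform r x + qform m x)"

lemma bilin_inner: "bilin A x y = x \<bullet> (A *v y)" for A :: "real ^'g ^'g"
  by (simp add: bilin_def inner_vec_def matrix_vector_mult_def sum_distrib_left mult.assoc)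

text \<open>The constant is the minimum of the form on the compact unit sphere; homogeneity extends
  the bound to all vectors.\<close>

lemma positive_definite_bound:
  fixes m :: "real ^'g ^'g"
  assumes "positive_definite m"
  obtains c where "c > 0" "\<And>x. c * (norm x)\<^sup>2 \<le> qform m x"
proof -
  have "continuous_on (sphere (0 :: real ^'g) 1) (qform m)"
    unfolding qform_def bilin_def by (intro continuous_intros)
  moreover have "axis undefined 1 \<in> sphere (0 :: real ^'g) 1" by (simp add: norm_axis_1)
  ultimately obtain x0 :: "real ^'g" where x0: "norm x0 = 1"
    "\<And>x. norm x = 1 \<Longrightarrow> qform m x0 \<le> qform m x"
    using continuous_attains_inf[of "sphere (0 :: real ^'g) 1" "qform m"] by fastforce
  have "qform m x0 > 0"
    using assms x0(1) unfolding positive_definite_def by (metis norm_zero zero_neq_one)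
  moreover have "qform m x0 * (norm x)\<^sup>2 \<le> qform m x" for x
  proof (cases "x = 0")
    case True
    thus ?thesis by (simp add: qform_def bilin_def)
  next
    case False
    have "qform m x0 * (norm x)\<^sup>2 \<le> qform m ((1 / norm x) *s x) * (norm x)\<^sup>2"
      using False x0(2)[of "(1 / norm x) *s x"] 
      by (intro mult_right_mono) (auto simp: scalar_mult_eq_scaleR)
    also have "\<dots> = qform m x" using False by (simp add: qform_scale power_divide)
    finally show ?thesis .
  qed
  ultimately show ?thesis by (rule that)
qed

text \<open>Completing the square with \<open>u = m^(-1) r / 2\<close> leaves the constant
  \<open>n - m^(-1)[r] / 4\<close>, which the discriminant inequality makes positive.\<close>

lemma coercive_of_discriminant:
  fixes m :: "real ^'g ^'g"
  assumes sym: "transpose m = m" and pd: "positive_definite m"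
    and disc: "4 * real n > qform (matrix_inv m) (of_int_vec r)"
  shows "coercive m n r"
proof -
  obtain c where c: "c > 0" "\<And>x. c * (norm x)\<^sup>2 \<le> qform m x"
    using positive_definite_bound[OF pd] by blast
  have "\<forall>x. m *v x = 0 \<longrightarrow> x = 0"
    using pd unfolding positive_definite_def qform_def bilin_inner by force
  hence "\<exists>B. B ** m = mat 1" by (simp add: matrix_left_invertible_ker)
  hence "\<exists>B. m ** B = mat 1 \<and> B ** m = mat 1"
    using matrix_left_right_inverse by blast
  hence inv: "m ** matrix_inv m = mat 1"
    unfolding matrix_inv_def by (rule someI2_ex) blast
  define \<rho> :: "real ^'g" where "\<rho> = of_int_vec r"
  define u where "u = (1/2) *s (matrix_inv m *v \<rho>)"
  have mu: "m *v u = (1/2) *s \<rho>"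
    by (simp add: u_def matrix_vector_mult_scaleR scalar_mult_eq_scaleR matrix_vector_mul_assoc inv)
  have lin: "linform r x = x \<bullet> \<rho>" for x
    by (simp add: linform_def inner_vec_def \<rho>_def of_int_vec_def mult.commute)
  define \<epsilon> where "\<epsilon> = real n - qform (matrix_inv m) \<rho> / 4"
  have \<epsilon>: "\<epsilon> > 0" using disc by (simp add: \<epsilon>_def \<rho>_def)
  have square: "real n + linform r x + qform m x = qform m (x + u) + \<epsilon>" for x
  proof -
    have "qform m (x + u) = qform m x + 2 * bilin m x u + qform m u"
      by (simp add: qform_def bilin_add_left bilin_add_right bilin_commute[OF sym, of u x])
    moreover have "2 * bilin m x u = linform r x"
      by (simp add: bilin_inner mu lin scalar_mult_eq_scaleR)
    moreover have "qform m u = qform (matrix_inv m) \<rho> / 4"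
      by (simp add: qform_def bilin_inner mu scalar_mult_eq_scaleR) 
         (simp add: u_def scalar_mult_eq_scaleR inner_commute)
    ultimately show ?thesis by (simp add: \<epsilon>_def)
  qed
  \<comment> \<open>Since the squared norm of \<open>x\<close> is at most twice that of
    \<open>x + u\<close> plus twice that of \<open>u\<close>, the first entry of the minimum absorbs
    the quadratic part and the second the constant part.\<close>
  define \<delta> where "\<delta> = min (c / 2) (\<epsilon> / (1 + 2 * (norm u)\<^sup>2))"
  have pos: "1 + 2 * (norm u)\<^sup>2 > 0" by (intro add_pos_nonneg) auto
  have \<delta>: "\<delta> > 0" using c \<epsilon> pos by (simp add: \<delta>_def)
  have \<delta>1: "2 * \<delta> \<le> c" by (simp add: \<delta>_def)
  have "\<delta> \<le> \<epsilon> / (1 + 2 * (norm u)\<^sup>2)" by (simp add: \<delta>_def)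
  hence \<delta>2: "\<delta> * (1 + 2 * (norm u)\<^sup>2) \<le> \<epsilon>" using pos by (simp add: field_simps)
  have "\<delta> * (1 + (norm x)\<^sup>2) \<le> real n + linform r x + qform m x" for x
  proof -
    have "norm x \<le> norm (x + u) + norm u" using norm_triangle_ineq4[of "x + u" u] by simp
    hence "(norm x)\<^sup>2 \<le> (norm (x + u) + norm u)\<^sup>2" by (intro power_mono) auto
    also have "\<dots> \<le> 2 * (norm (x + u))\<^sup>2 + 2 * (norm u)\<^sup>2"
      using sum_squares_bound[of "norm (x + u)" "norm u"] by (simp add: power2_sum)
    finally have "\<delta> * (1 + (norm x)\<^sup>2) \<le> \<delta> * ((1 + 2 * (norm u)\<^sup>2) + 2 * (norm (x + u))\<^sup>2)"
      using \<delta> by (intro mult_left_mono) auto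
    also have "\<dots> = \<delta> * (1 + 2 * (norm u)\<^sup>2) + 2 * \<delta> * (norm (x + u))\<^sup>2"
      by (simp add: distrib_left)
    also have "\<dots> \<le> \<epsilon> + c * (norm (x + u))\<^sup>2"
      using \<delta>1 \<delta>2 by (intro add_mono mult_right_mono) auto
    also have "\<dots> \<le> \<epsilon> + qform m (x + u)" using c(2)[of "x + u"] by simp
    finally show ?thesis by (simp add: square)
  qed
  with \<delta> show ?thesis unfolding coercive_def by blast
qed

section \<open>The size of a single term\<close>

definition cvec :: "real ^'g \<Rightarrow> complex ^'g" where
  "cvec x = (\<chi> i. of_real (x $ i))"

lemma bilin_cvec: "bilin (cmat m) (cvec x) (cvec y) = of_real (bilin m x y)"
  by (simp add: bilin_def cmat_def cvec_def)

lemma linform_cvec: "linform r (cvec x) = of_real (linform r x)"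
  by (simp add: linform_def cvec_def)

lemma qpoly_cvec: "qpoly m n r (cvec x) = of_real (real n + linform r x + qform m x)"
  by (simp add: qpoly_def qform_def bilin_cvec linform_cvec)

lemma Im_moebius:
  assumes det: "a * d - b * c = (1 :: int)" and \<tau>: "Im \<tau> > 0"
  shows "Im ((of_int a * \<tau> + of_int b) / (of_int c * \<tau> + of_int d))
    = Im \<tau> / (norm (of_int c * \<tau> + of_int d))\<^sup>2"
proof -
  have "of_int a * of_int d - of_int b * of_int c = (1 :: real)"
    by (metis det of_int_diff of_int_mult of_int_1)
  hence *: "(of_int a * of_int d) * Im \<tau> - of_int b * of_int c * Im \<tau> = Im \<tau>"
    by (metis left_diff_distrib mult_1)
  show ?thesis
    unfolding Im_divide cmod_power2 using * by (simp add: algebra_simps)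
qed

lemma norm_e: "norm (e x) = exp (- (2 * pi * Im x))"
  by (simp add: e_def)

text \<open>In the real coordinates \<xi>, \<eta> of \<open>z\<close>, a real Heisenberg translation
  moves \<open>z\<close> to \<open>0\<close>. The exponent becomes a real value of the polynomial
  times the Moebius image of \<tau>, up to a real constant and a multiple of \<tau> independent of
  the matrix.\<close>

lemma norm_jterm:
  fixes m :: "real ^'g ^'g" and l :: "int ^'g"
  assumes m: "transpose m = m" and det: "a * d - b * c = 1" and \<tau>: "Im \<tau> > 0"
    and z: "z = \<tau> *s cvec \<xi> + cvec \<eta>"
  defines "x \<equiv> of_int_vec l + (of_int d *s \<xi> - of_int c *s \<eta>)"
  shows "norm (jterm k 1 m n r (a, b, c, d) l \<tau> z)
     = norm (of_int c * \<tau> + of_int d) powi (- k) * exp (2 * pi * (qform m \<xi> * Im \<tau>)) *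
       exp (- (2 * pi * ((real n + linform r x + qform m x)
                          * (Im \<tau> / (norm (of_int c * \<tau> + of_int d))\<^sup>2))))"
proof -
  have "(c, d) \<noteq> (0, 0)" using det by auto
  note J0 = automorphy_factor_nonzero[OF \<tau> this]
  have det': "of_int a * of_int d - of_int b * of_int c = (1 :: complex)"
    by (metis det of_int_diff of_int_mult of_int_1)
  have det'': "of_int a * of_int d - of_int b * of_int c = (1 :: real)"
    by (metis det of_int_diff of_int_mult of_int_1)
  define J where "J = of_int c * \<tau> + of_int d"
  define A where "A = of_int a * \<tau> + of_int b"
  \<comment> \<open>\<open>(x', y')\<close> is \<open>(\<xi>, \<eta>)\<close> times the inverse
    matrix, so that the translation in \<open>heisenberg_shift_exponent\<close> becomes
    \<open>(\<xi>, \<eta>)\<close>.\<close>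
  define x' where "x' = of_int d *s \<xi> - of_int c *s \<eta>"
  define y' where "y' = of_int a *s \<eta> - of_int b *s \<xi>"
  have "of_int a * (of_int d * X - of_int c * Y) + of_int c * (of_int a * Y - of_int b * X) = X"
       "of_int b * (of_int d * X - of_int c * Y) + of_int d * (of_int a * Y - of_int b * X) = Y"
    for X Y :: complex
    using det' by algebra+
  hence u: "of_int a *s cvec x' + of_int c *s cvec y' = cvec \<xi>"
       and v: "of_int b *s cvec x' + of_int d *s cvec y' = cvec \<eta>"
    by (simp_all add: vec_eq_iff x'_def y'_def cvec_def)
  have l: "of_int_vec l = cvec (of_int_vec l)"
    by (simp add: of_int_vec_def cvec_def vec_eq_iff)
  have lx: "of_int_vec l + cvec x' = cvec x"
    by (simp add: l x_def x'_def cvec_def vec_eq_iff)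
  define B where "B = linform r y' + 2 * bilin m (of_int_vec l) y' - of_int a * of_int b * qform m x'
      - 2 * of_int b * of_int c * bilin m x' y' - of_int c * of_int d * qform m y'"
  have [simp]: "bilin (cmat m) w 0 = 0" "qform (cmat m) 0 = 0" "linform r (0 :: complex ^'g) = 0" for w
    by (simp_all add: bilin_def qform_def linform_def)
  define E where "E = (qpoly m n r (of_int_vec l) * A - of_int c * qform (cmat m) z
      + (linform r z + 2 * bilin (cmat m) (of_int_vec l) z)) / J"
  have z': "z = 0 + \<tau> *s cvec \<xi> + cvec \<eta>" by (simp add: z)
  have "qform (cmat m) (cvec \<xi>) * \<tau> + E = qpoly m n r (cvec x) * A / J + of_real B"
    using heisenberg_shift_exponent[OF m det' J0, where x = "cvec x'" and y = "cvec y'"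
          and z = 0 and l = "of_int_vec l" and n = n and r = r]
    unfolding u v z'[symmetric] lx E_def A_def[symmetric] J_def[symmetric]
    by (simp add: l bilin_cvec linform_cvec qform_def B_def)
  hence "E = qpoly m n r (cvec x) * (A / J) + of_real B - qform (cmat m) (cvec \<xi>) * \<tau>"
    by (simp add: eq_diff_eq add.commute)
  hence "E = of_real (real n + linform r x + qform m x) * (A / J) + of_real B - of_real (qform m \<xi>) * \<tau>"
    by (simp only: qpoly_cvec qform_def bilin_cvec)
  hence Im_E: "Im E = (real n + linform r x + qform m x) * (Im \<tau> / (norm J)\<^sup>2) - qform m \<xi> * Im \<tau>"
  proof -
    have "Im (of_real X * w + of_real Y - of_real Z * \<tau>) = X * Im w - Z * Im \<tau>" for X Y Z w
      by simp
    with Im_moebius[OF det \<tau>] show ?thesis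
      using \<open>E = of_real _ * (A / J) + of_real B - _\<close> unfolding A_def[symmetric] J_def[symmetric]
      by metis
  qed
  have "jterm k 1 m n r (a, b, c, d) l \<tau> z = J powi (- k) * e E"
    by (simp add: E_def A_def J_def)
  hence "norm (jterm k 1 m n r (a, b, c, d) l \<tau> z) = norm J powi (- k) * exp (- (2 * pi * Im E))"
    by (simp add: norm_mult norm_power_int norm_e)
  also have "exp (- (2 * pi * Im E)) = exp (2 * pi * (qform m \<xi> * Im \<tau>)) *
      exp (- (2 * pi * ((real n + linform r x + qform m x) * (Im \<tau> / (norm J)\<^sup>2))))"
    by (simp add: Im_E exp_add[symmetric] algebra_simps)
  finally show ?thesis by (simp add: J_def mult.assoc)
qed

lemma complex_vec_split:
  assumes "Im \<tau> > 0"
  obtains \<xi> \<eta> where "z = \<tau> *s cvec \<xi> + cvec \<eta>"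
proof
  have "Z = \<tau> * of_real (Im Z / Im \<tau>) + of_real (Re Z - Im Z / Im \<tau> * Re \<tau>)" for Z
    using assms by (simp add: complex_eq_iff)
  thus "z = \<tau> *s cvec (\<chi> i. Im (z $ i) / Im \<tau>) + cvec (\<chi> i. Re (z $ i) - Im (z $ i) / Im \<tau> * Re \<tau>)"
    by (simp add: vec_eq_iff cvec_def)
qed

text \<open>Trading the exponential for a power \<open>-s\<close> costs a factor
  \<open>N^(2s)\<close>, where \<open>N\<close> is the norm of the automorphy factor, and gives
  decay in \<open>l\<close>. The remaining \<open>N^(2s-k)\<close> gives decay in
  \<open>(c, d)\<close>. The constant \<open>K\<close> does not depend on the matrix or on
  \<open>l\<close>.\<close>

lemma jterm_bound:
  fixes m :: "real ^'g ^'g"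
  assumes m: "transpose m = m" and co: "coercive m n r" and k: "k > int CARD('g) + 2"
    and \<tau>: "Im \<tau> > 0" and z: "z = \<tau> *s cvec \<xi> + cvec \<eta>"
  obtains t t' K where "t > 1/2" "t' > 1/2"
    "\<And>a b c d l. a * d - b * c = 1 \<Longrightarrow> norm (jterm k 1 m n r (a, b, c, d) l \<tau> z)
        \<le> K * ((decay t' (of_int c) * decay t' (of_int d)) *
            (\<Prod>i\<in>UNIV. decay t (of_int (l $ i + \<lfloor>of_int d * \<xi> $ i - of_int c * \<eta> $ i\<rfloor>))))"
proof -
  define g where "g = real CARD('g)"
  have "CARD('g) \<ge> 1" by (simp add: Suc_leI)
  hence g: "g \<ge> 1" by (simp add: g_def)
  \<comment> \<open>The sum over \<open>l\<close> needs \<open>2s > g\<close> and the sum over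
    \<open>(c, d)\<close> needs \<open>k - 2s > 2\<close>. The choice \<open>2s = g + 1/2\<close>
    meets both, as the integer \<open>k\<close> is at least \<open>g + 3\<close>.\<close>
  define t where "t = 1/2 + 1 / (4 * g)"
  define s where "s = g * t"
  have s: "s = g / 2 + 1/4" using g by (simp add: s_def t_def field_simps)
  have t: "t > 1/2" using g by (simp add: t_def)
  define t' where "t' = (of_int k - 2 * s) / 4"
  have "of_int k \<ge> g + 3" using k unfolding g_def by linarith
  hence t': "t' > 1/2" by (simp add: t'_def s)
  obtain \<delta> where \<delta>: "\<delta> > 0"
      "\<And>x. \<delta> * (1 + (norm x)\<^sup>2) \<le> real n + linform r x + qform m x"
    using co unfolding coercive_def by blast
  obtain K0 where K0: "K0 > 0" "\<And>c d. (c, d) \<noteq> (0, 0 :: int) \<Longrightarrow>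
       sqrt ((1 + (real_of_int c)\<^sup>2) * (1 + (real_of_int d)\<^sup>2)) \<le> K0 * (norm (of_int c * \<tau> + of_int d))\<^sup>2"
    using automorphy_factor_bound[OF \<tau>] by blast
  define \<kappa> where "\<kappa> = 2 * pi * \<delta> * Im \<tau>"
  have \<kappa>: "\<kappa> > 0" using \<delta> \<tau> by (simp add: \<kappa>_def)
  have s0: "s > 0" using g by (simp add: s)
  define E where "E = exp (2 * pi * (qform m \<xi> * Im \<tau>))"
  define K where "K = E * (\<kappa> / s) powr (- s) * (3 powr t) ^ CARD('g) * K0 powr (2 * t')"
  have "norm (jterm k 1 m n r (a, b, c, d) l \<tau> z)
        \<le> K * ((decay t' (of_int c) * decay t' (of_int d)) *
            (\<Prod>i\<in>UNIV. decay t (of_int (l $ i + \<lfloor>of_int d * \<xi> $ i - of_int c * \<eta> $ i\<rfloor>))))"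
    if det: "a * d - b * c = 1" for a b c d :: int and l :: "int ^'g"
  proof -
    define N where "N = norm (of_int c * \<tau> + of_int d)"
    have cd: "(c, d) \<noteq> (0, 0)" using det by auto
    have N: "N > 0" using automorphy_factor_nonzero[OF \<tau> cd] by (simp add: N_def)
    define x where "x = of_int_vec l + (of_int d *s \<xi> - of_int c *s \<eta>)"
    define P where "P = (\<Prod>i\<in>UNIV. decay t (of_int (l $ i + \<lfloor>of_int d * \<xi> $ i - of_int c * \<eta> $ i\<rfloor>)))"
    define X where "X = 1 + (norm x)\<^sup>2"
    have X: "X > 0" unfolding X_def by (intro add_pos_nonneg) auto
    define u where "u = \<kappa> / N\<^sup>2 * X"
    have u: "u > 0" using \<kappa> N X by (simp add: u_def)
    have "u = 2 * pi * ((\<delta> * X) * (Im \<tau> / N\<^sup>2))"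
      by (simp add: u_def \<kappa>_def)
    also have "\<dots> \<le> 2 * pi * ((real n + linform r x + qform m x) * (Im \<tau> / N\<^sup>2))"
      using \<delta>(2)[of x] \<tau> by (intro mult_left_mono mult_right_mono) (auto simp: X_def)
    finally have "exp (- (2 * pi * ((real n + linform r x + qform m x) * (Im \<tau> / N\<^sup>2)))) \<le> exp (- u)"
      by simp
    also have "\<dots> \<le> (u / s) powr (- s)" by (rule exp_minus_le_powr[OF u s0])
    also have "\<dots> = (\<kappa> / s) powr (- s) * (N\<^sup>2) powr s * X powr (- s)"
    proof -
      have "u / s = (\<kappa> / s) * X / N\<^sup>2" by (simp add: u_def)
      hence "(u / s) powr (- s) = (\<kappa> / s) powr (- s) * X powr (- s) / (N\<^sup>2) powr (- s)"
        using \<kappa> s0 X N by (simp add: powr_mult powr_divide)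
      also have "\<dots> = (\<kappa> / s) powr (- s) * (N\<^sup>2) powr s * X powr (- s)"
        by (simp add: powr_minus divide_inverse)
      finally show ?thesis .
    qed
    finally have exp: "exp (- (2 * pi * ((real n + linform r x + qform m x) * (Im \<tau> / N\<^sup>2))))
       \<le> (\<kappa> / s) powr (- s) * (N\<^sup>2) powr s * X powr (- s)" .
    have XP: "X powr (- s) \<le> (3 powr t) ^ CARD('g) * P"
    proof -
      have "X powr (- s) \<le> (\<Prod>i\<in>UNIV. decay t (x $ i))"
        unfolding X_def s_def g_def using t by (intro norm_decay_le_prod) auto
      also have "\<dots> \<le> (\<Prod>i\<in>UNIV. 3 powr t * decay t (of_int (l $ i + \<lfloor>of_int d * \<xi> $ i - of_int c * \<eta> $ i\<rfloor>)))"
      proof (intro prod_mono conjI decay_nonneg)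
        fix i
        have "x $ i = of_int (l $ i) + (of_int d * \<xi> $ i - of_int c * \<eta> $ i)"
          by (simp add: x_def of_int_vec_def)
        thus "decay t (x $ i) \<le> 3 powr t * decay t (of_int (l $ i + \<lfloor>of_int d * \<xi> $ i - of_int c * \<eta> $ i\<rfloor>))"
          using t decay_floor_shift[of t] by simp
      qed
      also have "\<dots> = (3 powr t) ^ CARD('g) * P" by (simp add: P_def prod.distrib)
      finally show ?thesis .
    qed
    have NN: "N powi (- k) * (N\<^sup>2) powr s \<le> K0 powr (2 * t') * (decay t' (of_int c) * decay t' (of_int d))"
    proof -
      define Q where "Q = (1 + (real_of_int c)\<^sup>2) * (1 + (real_of_int d)\<^sup>2)"
      have Q: "Q > 0" unfolding Q_def by (intro mult_pos_pos add_pos_nonneg) auto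
      have "N powi (- k) * (N\<^sup>2) powr s = N powr (- of_int k) * N powr (2 * s)"
        using N by (simp add: powr_real_of_int' powr_powr flip: powr_numeral of_int_minus)
      also have "\<dots> = (N\<^sup>2) powr (- (2 * t'))"
      proof -
        have "- of_int k + 2 * s = 2 * (- (2 * t'))" by (simp add: t'_def field_simps)
        thus ?thesis using N by (simp add: powr_powr powr_add[symmetric] flip: powr_numeral)
      qed
      also have "\<dots> \<le> (sqrt Q / K0) powr (- (2 * t'))"
        using K0(2)[OF cd] K0(1) Q t' by (intro powr_mono2') (auto simp: Q_def N_def field_simps)
      also have "\<dots> = K0 powr (2 * t') * Q powr (- t')"
        using K0(1) Q by (simp add: powr_divide powr_minus_divide powr_half_sqrt[symmetric] powr_powr)
      also have "Q powr (- t') = decay t' (of_int c) * decay t' (of_int d)"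
        by (simp add: Q_def decay_def powr_mult)
      finally show ?thesis .
    qed
    have "norm (jterm k 1 m n r (a, b, c, d) l \<tau> z) =
        N powi (- k) * E * exp (- (2 * pi * ((real n + linform r x + qform m x) * (Im \<tau> / N\<^sup>2))))"
      unfolding norm_jterm[OF m det \<tau> z] by (simp add: N_def E_def x_def)
    also have "\<dots> \<le> N powi (- k) * E * ((\<kappa> / s) powr (- s) * (N\<^sup>2) powr s * X powr (- s))"
      using N by (intro mult_left_mono exp) (auto simp: E_def)
    also have "\<dots> = E * (\<kappa> / s) powr (- s) * (N powi (- k) * (N\<^sup>2) powr s) * X powr (- s)"
      by (simp add: mult_ac)
    also have "\<dots> \<le> E * (\<kappa> / s) powr (- s) * (K0 powr (2 * t') * (decay t' (of_int c) * decay t' (of_int d)))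
        * ((3 powr t) ^ CARD('g) * P)"
      using N by (intro mult_mono mult_left_mono NN XP mult_nonneg_nonneg decay_nonneg) (auto simp: E_def)
    also have "\<dots> = K * ((decay t' (of_int c) * decay t' (of_int d)) * P)"
      by (simp add: K_def mult_ac)
    finally show ?thesis by (simp add: P_def)
  qed
  with t t' show ?thesis by (rule that)
qed

text \<open>The bottom row determines the representative, so \<open>h\<close> is injective although
  its integral shift of \<open>l\<close> varies with \<open>(c, d)\<close>. The majorant
  \<open>F\<close> is a product of convergent one-dimensional sums.\<close>

theorem summable_jterm:
  fixes m :: "real ^'g ^'g"
  assumes m: "transpose m = m" and co: "coercive m n r" and k: "k > int CARD('g) + 2"
    and \<tau>: "Im \<tau> > 0"
  shows "(\<lambda>(M, l). jterm k 1 m n r M l \<tau> z) summable_on sl2_reps \<times> UNIV"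
proof -
  obtain \<xi> \<eta> where z: "z = \<tau> *s cvec \<xi> + cvec \<eta>"
    using complex_vec_split[OF \<tau>] by blast
  obtain t t' K where t: "t > 1/2" "t' > 1/2"
    and K: "\<And>a b c d l. a * d - b * c = 1 \<Longrightarrow> norm (jterm k 1 m n r (a, b, c, d) l \<tau> z)
        \<le> K * ((decay t' (of_int c) * decay t' (of_int d)) *
            (\<Prod>i\<in>UNIV. decay t (of_int (l $ i + \<lfloor>of_int d * \<xi> $ i - of_int c * \<eta> $ i\<rfloor>))))"
    using jterm_bound[OF m co k \<tau> z] by blast
  define F :: "(int \<times> int) \<times> (int ^'g) \<Rightarrow> real" where
    "F = (\<lambda>(p, v). (case p of (c, d) \<Rightarrow> decay t' (of_int c) * decay t' (of_int d)) *
              (\<Prod>i\<in>UNIV. decay t (of_int (v $ i))))"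
  define h :: "quad \<times> (int ^'g) \<Rightarrow> (int \<times> int) \<times> (int ^'g)" where
    "h = (\<lambda>((a, b, c, d), l). ((c, d), l + (\<chi> i. \<lfloor>of_int d * \<xi> $ i - of_int c * \<eta> $ i\<rfloor>)))"
  have "F summable_on (UNIV \<times> UNIV) \<times> UNIV"
    unfolding F_def
    by (intro summable_on_prod_mult summable_on_vec_prod summable_on_decay_int t)
       (auto intro!: mult_nonneg_nonneg prod_nonneg decay_nonneg)
  hence F: "F summable_on h ` (sl2_reps \<times> UNIV)"
    by (rule summable_on_subset) auto
  have inj: "inj_on h (sl2_reps \<times> UNIV)"
    by (rule inj_onI) (auto simp: h_def dest: sl2_reps_unique)
  have "(\<lambda>x. K * F (h x)) summable_on sl2_reps \<times> UNIV"
    using F unfolding summable_on_reindex[OF inj] o_def by (rule summable_on_cmult_right)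
  hence "(\<lambda>x. norm (case x of (M, l) \<Rightarrow> jterm k 1 m n r M l \<tau> z)) summable_on sl2_reps \<times> UNIV"
  proof (rule Infinite_Sum.abs_summable_on_comparison_test')
    fix X :: "quad \<times> (int ^'g)" assume X: "X \<in> sl2_reps \<times> UNIV"
    obtain a b c d l where Xe: "X = ((a, b, c, d), l)" by (cases X) auto
    have "a * d - b * c = 1" using X sl2_reps_det by (simp add: Xe)
    from K[OF this, of l] show "norm (case X of (M, l) \<Rightarrow> jterm k 1 m n r M l \<tau> z) \<le> K * F (h X)"
      by (simp add: Xe F_def h_def del: jterm.simps)
  qed
  thus ?thesis by (rule abs_summable_summable)
qed

section \<open>Matrices of prime determinant\<close>

fun qmul :: "quad \<Rightarrow> quad \<Rightarrow> quad" where
  "qmul (a, b, c, d) (a', b', c', d') = (a * a' + b * c', a * b' + b * d', c * a' + d * c', c * b' + d * d')"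

fun translate :: "int \<Rightarrow> quad \<Rightarrow> quad" where
  "translate s (a, b, c, d) = (a + s * c, b + s * d, c, d)"

fun qdet :: "quad \<Rightarrow> int" where
  "qdet (a, b, c, d) = a * d - b * c"

text \<open>For prime \<open>p\<close>, the upper triangular representatives of the integral
  matrices of determinant \<open>p\<close> modulo left multiplication by SL(2, \<int>).\<close>

definition hecke_reps :: "nat \<Rightarrow> quad set" where
  "hecke_reps p = insert (int p, 0, 0, 1) ((\<lambda>t. (1, int t, 0, int p)) ` {..<p})"

lemma qdet_mult: "qdet (qmul A B) = qdet A * qdet B"
  by (cases A; cases B) (simp add: algebra_simps)

lemma qdet_translate: "qdet (translate s A) = qdet A"
  by (cases A) (simp add: algebra_simps)

lemma qmul_translate: "qmul (translate s A) B = translate s (qmul A B)"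
  by (cases A; cases B) (simp add: algebra_simps)

lemma translate_translate: "translate s (translate t A) = translate (s + t) A"
  by (cases A) (simp add: algebra_simps)

lemma finite_hecke_reps: "finite (hecke_reps p)"
  by (simp add: hecke_reps_def)

lemma qdet_hecke_reps: "\<rho> \<in> hecke_reps p \<Longrightarrow> qdet \<rho> = int p"
  by (auto simp: hecke_reps_def)

lemma hecke_reps_cases:
  assumes "\<rho> \<in> hecke_reps p"
  obtains "\<rho> = (int p, 0, 0, 1)" | t where "\<rho> = (1, int t, 0, int p)" "t < p"
  using assms by (auto simp: hecke_reps_def)

lemma sl2_reps_exists_translate:
  assumes "qdet A = 1"
  shows "\<exists>M\<in>sl2_reps. \<exists>s. A = translate s M"
proof -
  obtain a b c d where A: "A = (a, b, c, d)" by (cases A)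
  from assms have "a * d - b * c = 1" by (simp add: A)
  from sl2_reps_exists[OF this] obtain s where "(a + s * c, b + s * d, c, d) \<in> sl2_reps" by blast
  moreover have "A = translate (- s) (a + s * c, b + s * d, c, d)" by (simp add: A)
  ultimately show ?thesis by blast
qed

lemma prime_solve_cong:
  assumes p: "prime p" and x: "\<not> int p dvd x"
  obtains t where "t < p" "int p dvd y - x * int t"
proof -
  have "coprime x (int p)"
    using p x prime_imp_coprime[of "int p" x] by (simp add: coprime_commute)
  then obtain u v where "u * x + v * int p = 1"
    using bezout_int[of x "int p"] by auto
  hence uv: "x * u = 1 - v * int p" by (simp add: algebra_simps)
  define t where "t = nat ((u * y) mod int p)"
  have p0: "int p > 0" using p prime_gt_0_nat by simp
  hence t: "int t = (u * y) mod int p" by (simp add: t_def)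
  have "t < p" using p0 t by (metis of_nat_less_iff pos_mod_bound)
  moreover have "y - x * int t = int p * (y * v + x * q)" if "int t = u * y - int p * q" for q
  proof -
    have "y - x * int t = y - (x * u) * y + int p * (x * q)"
      unfolding that by (simp add: algebra_simps)
    also have "\<dots> = int p * (y * v + x * q)"
      unfolding uv by (simp add: algebra_simps)
    finally show ?thesis .
  qed
  from this[of "(u * y) div int p"] have "int p dvd y - x * int t"
    by (simp add: t minus_mult_div_eq_mod)
  ultimately show ?thesis by (rule that)
qed

text \<open>Representatives of different shape would force \<open>p\<close> to divide 1. For two of
  the shape \<open>(1, t, 0, p)\<close>, \<open>p\<close> divides \<open>t - t'\<close> times each
  entry of the primitive first column, hence \<open>t - t'\<close> itself.\<close>

lemma hecke_right_unique:
  assumes p: "prime p" and M: "M \<in> sl2_reps" "M' \<in> sl2_reps"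
    and \<rho>: "\<rho> \<in> hecke_reps p" "\<rho>' \<in> hecke_reps p"
    and eq: "qmul M \<rho> = translate s (qmul M' \<rho>')"
  shows "M = M' \<and> \<rho> = \<rho>'"
proof -
  obtain a b c d where Me: "M = (a, b, c, d)" by (cases M)
  obtain a' b' c' d' where Me': "M' = (a', b', c', d')" by (cases M')
  have det: "a * d - b * c = 1" "a' * d' - b' * c' = 1"
    using M sl2_reps_det by (auto simp: Me Me')
  have p1: "\<not> int p dvd 1" using p by (metis int_dvd_int_iff of_nat_1 not_prime_unit)
  have uniq: "c = c' \<Longrightarrow> d = d' \<Longrightarrow> M = M'"
    using M sl2_reps_unique by (auto simp: Me Me')
  have p0: "p > 0" using p prime_gt_0_nat by simp
  show ?thesis
    using \<rho>(1)
  proof (cases rule: hecke_reps_cases)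
    case 1
    show ?thesis using \<rho>(2)
    proof (cases rule: hecke_reps_cases)
      case e': 1
      have "c = c'" "d = d'" using eq p0 by (auto simp: Me Me' 1 e')
      thus ?thesis using uniq 1 e' by simp
    next
      case e': (2 t)
      have "a' + s * c' = int p * a" "c' = int p * c"
        using eq by (auto simp: Me Me' 1 e' mult.commute)
      moreover have "(a' + s * c') * d' - (b' + s * d') * c' = 1" using det by (simp add: algebra_simps)
      ultimately have "int p * (a * d' - (b' + s * d') * c) = 1" by (simp add: algebra_simps)
      with p1 show ?thesis by (metis dvd_triv_left)
    qed
  next
    case t: (2 t)
    show ?thesis using \<rho>(2)
    proof (cases rule: hecke_reps_cases)
      case 1
      have "a = int p * (a' + s * c')" "c = int p * c'"
        using eq by (auto simp: Me Me' 1 t algebra_simps)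
      hence "int p * ((a' + s * c') * d - b * c') = 1" using det by (simp add: algebra_simps)
      with p1 show ?thesis by (metis dvd_triv_left)
    next
      case t': (2 t')
      have c: "c = c'" and a: "a = a' + s * c"
        and d: "c * int t + d * int p = c * int t' + d' * int p"
        and b: "a * int t + b * int p = a' * int t' + b' * int p + s * (c * int t' + d' * int p)"
        using eq by (auto simp: Me Me' t t')
      have ct: "c * (int t - int t') = int p * (d' - d)" using d by (simp add: algebra_simps)
      have ca: "a * (int t - int t') = int p * (b' + s * d' - b)" using b by (simp add: a algebra_simps)
      have "int t - int t' = d * (a * (int t - int t')) - b * (c * (int t - int t'))"
        using det(1) by algebra
      also have "\<dots> = int p * (d * (b' + s * d' - b) - b * (d' - d))"
        unfolding ct ca by (simp add: algebra_simps)
      finally have "int p dvd int t - int t'" by simp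
      moreover have "\<bar>int t - int t'\<bar> < int p" using t(2) t'(2) by linarith
      ultimately have tt: "t = t'" by (metis dvd_imp_le_int abs_of_nat eq_iff_diff_eq_0 not_less of_nat_eq_iff)
      with d p0 have "d = d'" by simp
      with c tt show ?thesis using uniq t t' by simp
    qed
  qed
qed

text \<open>If \<open>p\<close> divides the first column, it can be taken out. Otherwise some
  \<open>t\<close> makes the second column congruent to \<open>t\<close> times the first; one row
  determines \<open>t\<close>, and the other follows because the determinant vanishes modulo
  \<open>p\<close>.\<close>

lemma hecke_right_exists:
  assumes p: "prime p" and G: "qdet G = int p"
  shows "\<exists>M\<in>sl2_reps. \<exists>\<rho>\<in>hecke_reps p. \<exists>s. G = translate s (qmul M \<rho>)"
proof -
  have p0: "int p \<noteq> 0" using p by (metis not_prime_0 of_nat_eq_0_iff)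
  have pp: "prime (int p)" using p by simp
  obtain x y u v where Ge: "G = (x, y, u, v)" by (cases G)
  have det: "x * v - y * u = int p" using G by (simp add: Ge)
  have "\<exists>A. \<exists>\<rho>\<in>hecke_reps p. qdet A = 1 \<and> G = qmul A \<rho>"
  proof (cases "int p dvd x \<and> int p dvd u")
    case True
    then obtain x' u' where xu: "x = int p * x'" "u = int p * u'" by (auto elim!: dvdE)
    have "int p * (x' * v - y * u') = int p * 1" using det by (simp add: xu algebra_simps)
    hence "x' * v - y * u' = 1" using p0 by simp
    thus ?thesis
      by (intro exI[of _ "(x', y, u', v)"] bexI[of _ "(int p, 0, 0, 1)"])
         (auto simp: Ge xu hecke_reps_def mult.commute)
  next
    case False
    have "\<exists>t<p. int p dvd y - x * int t \<and> int p dvd v - u * int t"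
    proof (cases "int p dvd x")
      case x: False
      obtain t where t: "t < p" "int p dvd y - x * int t"
        using prime_solve_cong[OF p x] by blast
      have "x * (v - u * int t) = int p + u * (y - x * int t)"
        using det by (simp add: algebra_simps)
      hence "int p dvd x * (v - u * int t)" using t(2) by (simp add: dvd_add)
      with x pp t show ?thesis by (meson prime_dvd_mult_iff)
    next
      case True
      with False have u: "\<not> int p dvd u" by simp
      obtain t where t: "t < p" "int p dvd v - u * int t"
        using prime_solve_cong[OF p u] by blast
      have "u * (y - x * int t) = x * (v - u * int t) - int p"
        using det by (simp add: algebra_simps)
      hence "int p dvd u * (y - x * int t)" using t(2) by (simp add: dvd_diff)
      with u pp t show ?thesis by (meson prime_dvd_mult_iff)
    qed
    then obtain t y' v' where t: "t < p" "y - x * int t = int p * y'" "v - u * int t = int p * v'"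
      by (auto elim!: dvdE)
    have "int p * (x * v' - y' * u) = x * (v - u * int t) - (y - x * int t) * u"
      unfolding t(2,3) by (simp add: algebra_simps)
    also have "\<dots> = int p * 1" using det by (simp add: algebra_simps)
    finally have "x * v' - y' * u = 1" using p0 by simp
    moreover have "y = x * int t + y' * int p" "v = u * int t + v' * int p"
      using t by (simp_all add: algebra_simps)
    ultimately show ?thesis using t(1)
      by (intro exI[of _ "(x, y', u, v')"] bexI[of _ "(1, int t, 0, int p)"])
         (auto simp: Ge hecke_reps_def)
  qed
  then obtain A \<rho> where A: "\<rho> \<in> hecke_reps p" "qdet A = 1" "G = qmul A \<rho>" by blast
  with sl2_reps_exists_translate[OF A(2)] show ?thesis by (metis qmul_translate)
qed

text \<open>The bottom row of the product is primitive for \<open>(p, 0, 0, 1)\<close> and divisible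
  by \<open>p\<close> otherwise. It thus gives the shape and \<open>M\<close>, and the top row gives
  \<open>t\<close> modulo \<open>p\<close>.\<close>

lemma hecke_left_unique:
  assumes p: "prime p" and M: "M \<in> sl2_reps" "M' \<in> sl2_reps"
    and \<rho>: "\<rho> \<in> hecke_reps p" "\<rho>' \<in> hecke_reps p"
    and eq: "qmul \<rho> M = translate s (qmul \<rho>' M')"
  shows "M = M' \<and> \<rho> = \<rho>'"
proof -
  obtain a b c d where Me: "M = (a, b, c, d)" by (cases M)
  obtain a' b' c' d' where Me': "M' = (a', b', c', d')" by (cases M')
  have det: "a * d - b * c = 1" "a' * d' - b' * c' = 1"
    using M sl2_reps_det by (auto simp: Me Me')
  have p1: "\<not> int p dvd 1" using p by (metis int_dvd_int_iff of_nat_1 not_prime_unit)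
  have uniq: "c = c' \<Longrightarrow> d = d' \<Longrightarrow> M = M'"
    using M sl2_reps_unique by (auto simp: Me Me')
  have p0: "p > 0" using p prime_gt_0_nat by simp
  show ?thesis
    using \<rho>(1)
  proof (cases rule: hecke_reps_cases)
    case 1
    show ?thesis using \<rho>(2)
    proof (cases rule: hecke_reps_cases)
      case e': 1
      have "c = c'" "d = d'" using eq p0 by (auto simp: Me Me' 1 e')
      thus ?thesis using uniq 1 e' by simp
    next
      case e': (2 t)
      have "c = int p * c'" "d = int p * d'" using eq by (auto simp: Me Me' 1 e')
      hence "int p * (a * d' - b * c') = 1" using det by (simp add: algebra_simps)
      with p1 show ?thesis by (metis dvd_triv_left)
    qed
  next
    case t: (2 t)
    show ?thesis using \<rho>(2)
    proof (cases rule: hecke_reps_cases)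
      case 1
      have "c' = int p * c" "d' = int p * d" using eq by (auto simp: Me Me' 1 t)
      hence "int p * (a' * d - b' * c) = 1" using det by (simp add: algebra_simps)
      with p1 show ?thesis by (metis dvd_triv_left)
    next
      case t': (2 t')
      have cd: "c = c'" "d = d'" using eq p0 by (auto simp: Me Me' t t')
      with uniq have MM: "M = M'" by simp
      hence ab: "a = a'" "b = b'" by (simp_all add: Me Me')
      have 1: "a + int t * c = a + int t' * c + s * (int p * c)"
              "b + int t * d = b + int t' * d + s * (int p * d)"
        using eq by (auto simp: Me Me' t t' ab cd)
      have "(int t - int t' - s * int p) * c = 0" "(int t - int t' - s * int p) * d = 0"
        using 1 by (simp_all add: algebra_simps)
      moreover have "c \<noteq> 0 \<or> d \<noteq> 0" using det by auto
      ultimately have "int t - int t' = s * int p" by auto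
      hence "int p dvd int t - int t'" by simp
      moreover have "\<bar>int t - int t'\<bar> < int p" using t(2) t'(2) by linarith
      ultimately have "t = t'" by (metis dvd_imp_le_int abs_of_nat eq_iff_diff_eq_0 not_less of_nat_eq_iff)
      with MM t t' show ?thesis by simp
    qed
  qed
qed

text \<open>The gcd of the bottom row divides \<open>p\<close>. If it is \<open>p\<close>, dividing
  it out leaves determinant 1 and the translation is reduced modulo \<open>p\<close>; if it is 1,
  the bottom row is that of some \<open>M\<close>.\<close>

lemma hecke_left_exists:
  assumes p: "prime p" and G: "qdet G = int p"
  shows "\<exists>M\<in>sl2_reps. \<exists>\<rho>\<in>hecke_reps p. \<exists>s. G = translate s (qmul \<rho> M)"
proof -
  have p0: "int p > 0" using p prime_gt_0_nat by simp
  have pp: "prime (int p)" using p by simp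
  obtain x y u v where Ge: "G = (x, y, u, v)" by (cases G)
  have det: "x * v - y * u = int p" using G by (simp add: Ge)
  have "gcd u v dvd int p" unfolding det[symmetric] by (intro dvd_diff dvd_mult) auto
  hence "gcd u v = 1 \<or> gcd u v = int p"
    using pp by (metis gcd_ge_0_int prime_int_iff)
  thus ?thesis
  proof
    assume "gcd u v = int p"
    hence "int p dvd u" "int p dvd v" by (metis gcd_dvd1, metis gcd_dvd2)
    then obtain c d where cd: "u = int p * c" "v = int p * d" by (auto elim!: dvdE)
    have "int p * (x * d - y * c) = int p * 1" using det by (simp add: cd algebra_simps)
    hence "x * d - y * c = 1" using p0 by simp
    hence "qdet (x, y, c, d) = 1" by simp
    then obtain M s where M: "M \<in> sl2_reps" "(x, y, c, d) = translate s M"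
      using sl2_reps_exists_translate by metis
    obtain a b where Me: "M = (a, b, c, d)" and ab: "x = a + s * c" "y = b + s * d"
      using M(2) by (cases M) auto
    define t where "t = nat (s mod int p)"
    have t: "int t = s mod int p" using p0 by (simp add: t_def)
    have "t < p" using p0 t by (metis of_nat_less_iff pos_mod_bound)
    moreover have "s = int t + (s div int p) * int p" by (simp add: t)
    hence "x = a + int t * c + (s div int p) * (int p * c)" "y = b + int t * d + (s div int p) * (int p * d)"
      unfolding ab by algebra+
    ultimately show ?thesis using M
      by (intro bexI[of _ M] bexI[of _ "(1, int t, 0, int p)"] exI[of _ "s div int p"])
         (auto simp: Ge Me cd hecke_reps_def)
  next
    assume "gcd u v = 1"
    then obtain w1 w2 where "w1 * u + w2 * v = 1" using bezout_int[of u v] by auto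
    hence "qdet (w2, - w1, u, v) = 1" by simp
    then obtain M s0 where M: "M \<in> sl2_reps" "(w2, - w1, u, v) = translate s0 M"
      using sl2_reps_exists_translate by metis
    obtain a b where Me: "M = (a, b, u, v)" using M(2) by (cases M) auto
    have 1: "a * v - b * u = 1" using M(1) sl2_reps_det by (simp add: Me)
    have "x = int p * a + (a * y - b * x) * u" "y = int p * b + (a * y - b * x) * v"
      unfolding det[symmetric] using 1 by algebra+
    thus ?thesis using M(1)
      by (intro bexI[of _ M] bexI[of _ "(int p, 0, 0, 1)"] exI[of _ "a * y - b * x"])
         (auto simp: Ge Me hecke_reps_def)
  qed
qed

text \<open>Both sides represent the matrices of determinant \<open>p\<close> up to translation: on the left as
  \<open>\<Gamma>\<^sub>\<infinity>\<close>-orbits of \<open>SL\<^sub>2(\<int>) \<rho>\<close>, on the right as those of \<open>\<rho> SL\<^sub>2(\<int>)\<close>.\<close>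

lemma hecke_exchange:
  assumes p: "prime p"
  obtains h where "bij_betw h (hecke_reps p \<times> sl2_reps) (hecke_reps p \<times> sl2_reps)"
    "\<And>\<rho> M. \<rho> \<in> hecke_reps p \<Longrightarrow> M \<in> sl2_reps \<Longrightarrow>
       \<exists>s. qmul M \<rho> = translate s (qmul (fst (h (\<rho>, M))) (snd (h (\<rho>, M))))"
proof -
  define X where "X = hecke_reps p \<times> sl2_reps"
  have M_det: "qdet M = 1" if "M \<in> sl2_reps" for M
    using that sl2_reps_det by (cases M) auto
  have "\<forall>x\<in>X. \<exists>y. y \<in> X \<and> (\<exists>s. qmul (snd x) (fst x) = translate s (qmul (fst y) (snd y)))"
  proof
    fix x assume "x \<in> X"
    hence "qdet (qmul (snd x) (fst x)) = int p"
      by (simp add: X_def qdet_mult qdet_hecke_reps M_det mem_Times_iff)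
    from hecke_left_exists[OF p this]
    show "\<exists>y. y \<in> X \<and> (\<exists>s. qmul (snd x) (fst x) = translate s (qmul (fst y) (snd y)))"
      by (force simp: X_def)
  qed
  then obtain h where h: "\<And>x. x \<in> X \<Longrightarrow> h x \<in> X"
    "\<And>x. x \<in> X \<Longrightarrow> \<exists>s. qmul (snd x) (fst x) = translate s (qmul (fst (h x)) (snd (h x)))"
    by metis
  \<comment> \<open>Injectivity is uniqueness of the factorisation with \<open>\<rho>\<close> on the
    right; surjectivity is its existence together with uniqueness on the left.\<close>
  have "bij_betw h X X"
    unfolding bij_betw_def
  proof (intro conjI inj_onI equalityI subsetI)
    fix x x' assume x: "x \<in> X" "x' \<in> X" and eq: "h x = h x'"
    obtain s s' where s: "qmul (snd x) (fst x) = translate s (qmul (fst (h x)) (snd (h x)))"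
      "qmul (snd x') (fst x') = translate s' (qmul (fst (h x)) (snd (h x)))"
      using h(2) x eq by metis
    hence "qmul (snd x) (fst x) = translate (s - s') (qmul (snd x') (fst x'))"
      by (simp add: translate_translate)
    from hecke_right_unique[OF p _ _ _ _ this] x show "x = x'"
      by (auto simp: X_def prod_eq_iff)
  next
    fix y assume y: "y \<in> X"
    hence "qdet (qmul (fst y) (snd y)) = int p"
      by (simp add: X_def qdet_mult qdet_hecke_reps M_det mem_Times_iff)
    from hecke_right_exists[OF p this] obtain x s where x: "x \<in> X"
      "qmul (fst y) (snd y) = translate s (qmul (snd x) (fst x))"
      by (force simp: X_def)
    obtain s' where "qmul (snd x) (fst x) = translate s' (qmul (fst (h x)) (snd (h x)))"
      using h(2) x(1) by blast
    hence "qmul (fst y) (snd y) = translate (s + s') (qmul (fst (h x)) (snd (h x)))"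
      by (simp add: x(2) translate_translate)
    from hecke_left_unique[OF p _ _ _ _ this] h(1)[OF x(1)] y have "y = h x"
      by (auto simp: X_def prod_eq_iff)
    thus "y \<in> h ` X" using x(1) by blast
  qed (use h(1) in auto)
  with h(2) show ?thesis by (intro that[of h]) (auto simp: X_def)
qed

section \<open>The Hecke operator on Poincar\'e series\<close>

text \<open>Coercivity stands in for positive definiteness and the discriminant inequality, so that
  rescaling the data involves no matrix inverse.\<close>

definition jacobi_datum :: "real ^'g ^'g \<Rightarrow> nat \<Rightarrow> int ^'g \<Rightarrow> bool" where
  "jacobi_datum m n r \<longleftrightarrow> transpose m = m \<and> half_integral m \<and> coercive m n r"

lemma jacobi_datumD:
  assumes "jacobi_datum m n r"
  shows "transpose m = m" "half_integral m" "coercive m n r"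
  using assms by (auto simp: jacobi_datum_def)

lemma half_integral_scaleR:
  assumes "half_integral m"
  shows "half_integral (real N *\<^sub>R m)"
proof -
  from assms obtain M :: "int ^'a ^'a"
    where "\<And>i j. 2 * m $ i $ j = of_int (M $ i $ j)" "\<And>i. even (M $ i $ i)"
    unfolding half_integral_def by blast
  thus ?thesis unfolding half_integral_def
    by (intro exI[of _ "\<chi> i j. int N * M $ i $ j"]) (auto simp: mult.left_commute[of 2])
qed

lemma qform_scaleR: "qform (s *\<^sub>R m) x = s * qform m x" for m :: "real ^'g ^'g"
  by (simp add: qform_def bilin_def sum_distrib_left mult_ac)

lemma jacobi_datum_scale:
  assumes m: "jacobi_datum m n r" and N: "N > 0"
  shows "jacobi_datum (real N *\<^sub>R m) (N * n) (int N *s r)"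
proof -
  obtain \<delta> where \<delta>: "\<delta> > 0" "\<And>x. \<delta> * (1 + (norm x)\<^sup>2) \<le> real n + linform r x + qform m x"
    using jacobi_datumD(3)[OF m] unfolding coercive_def by blast
  have "(real N * \<delta>) * (1 + (norm x)\<^sup>2)
      \<le> real (N * n) + linform (int N *s r) x + qform (real N *\<^sub>R m) x" for x
    using mult_left_mono[OF \<delta>(2)[of x], of "real N"]
    by (simp add: linform_smult qform_scaleR distrib_left mult.assoc)
  moreover have "real N * \<delta> > 0" using N \<delta> by simp
  ultimately have "coercive (real N *\<^sub>R m) (N * n) (int N *s r)"
    unfolding coercive_def by blast
  thus ?thesis using jacobi_datumD(1,2)[OF m]
    by (simp add: jacobi_datum_def half_integral_scaleR transpose_def vec_eq_iff)
qed

text \<open>The new polynomial is the old one evaluated at \<open>N x\<close>, and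
  \<open>N \<ge> 1\<close> does not shorten vectors.\<close>

lemma jacobi_datum_square:
  assumes m: "jacobi_datum m n r" and N: "N > 0"
  shows "jacobi_datum (real N ^ 2 *\<^sub>R m) n (int N *s r)"
proof -
  obtain \<delta> where \<delta>: "\<delta> > 0" "\<And>x. \<delta> * (1 + (norm x)\<^sup>2) \<le> real n + linform r x + qform m x"
    using jacobi_datumD(3)[OF m] unfolding coercive_def by blast
  have "\<delta> * (1 + (norm x)\<^sup>2) \<le> real n + linform (int N *s r) x + qform (real N ^ 2 *\<^sub>R m) x" for x
  proof -
    have "norm x \<le> real N * norm x" using N mult_right_mono[of 1 "real N" "norm x"] by simp
    hence "norm x \<le> norm (real N *s x)" by (simp add: scalar_mult_eq_scaleR)
    hence "(norm x)\<^sup>2 \<le> (norm (real N *s x))\<^sup>2" by (intro power_mono) auto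
    hence "\<delta> * (1 + (norm x)\<^sup>2) \<le> \<delta> * (1 + (norm (real N *s x))\<^sup>2)"
      using \<delta> by (intro mult_left_mono) auto
    also have "\<dots> \<le> real n + linform r (real N *s x) + qform m (real N *s x)" by (rule \<delta>(2))
    also have "\<dots> = real n + linform (int N *s r) x + qform (real N ^ 2 *\<^sub>R m) x"
      by (simp add: linform_smult linform_scale qform_scaleR qform_scale)
    finally show ?thesis .
  qed
  with \<delta> have "coercive (real N ^ 2 *\<^sub>R m) n (int N *s r)"
    unfolding coercive_def by blast
  thus ?thesis using jacobi_datumD(1,2)[OF m] half_integral_scaleR[of m "N ^ 2"]
    by (simp add: jacobi_datum_def transpose_def vec_eq_iff)
qed

lemma jacobi_poincare_has_sum:
  fixes m :: "real ^'g ^'g"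
  assumes "jacobi_datum m n r" "k > int CARD('g) + 2" "Im \<tau> > 0"
  shows "((\<lambda>(M, l). jterm k 1 m n r M l \<tau> z) has_sum jacobi_poincare k m n r \<tau> z)
           (sl2_reps \<times> UNIV)"
  unfolding jacobi_poincare_eq[OF jacobi_datumD(1,2)[OF assms(1)] assms(3)]
  using jacobi_datumD[OF assms(1)] assms by (intro has_sum_infsum summable_jterm)

lemma has_sum_finite_times:
  fixes f :: "'a \<Rightarrow> 'b \<Rightarrow> 'c :: topological_comm_monoid_add"
  assumes R: "finite R" and f: "\<And>\<rho>. \<rho> \<in> R \<Longrightarrow> (f \<rho> has_sum S \<rho>) A"
  shows "((\<lambda>(\<rho>, x). f \<rho> x) has_sum (\<Sum>\<rho>\<in>R. S \<rho>)) (R \<times> A)"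
proof -
  have "((\<lambda>(\<rho>, x). f \<rho> x) has_sum (\<Sum>\<rho>\<in>R. S \<rho>)) (\<Union>\<rho>\<in>R. {\<rho>} \<times> A)"
  proof (rule sum_has_sum[OF R])
    fix \<rho> assume "\<rho> \<in> R"
    have "((\<lambda>(\<rho>, x). f \<rho> x) has_sum S \<rho>) ({\<rho>} \<times> A) \<longleftrightarrow> (f \<rho> has_sum S \<rho>) A"
      by (rule has_sum_reindex_bij_witness[of _ "Pair \<rho>" snd]) auto
    with f[OF \<open>\<rho> \<in> R\<close>] show "((\<lambda>(\<rho>, x). f \<rho> x) has_sum S \<rho>) ({\<rho>} \<times> A)" by blast
  qed auto
  also have "(\<Union>\<rho>\<in>R. {\<rho>} \<times> A) = R \<times> A" by auto
  finally show ?thesis .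
qed

definition hecke_V ::
    "nat \<Rightarrow> int \<Rightarrow> (complex \<Rightarrow> complex ^'g \<Rightarrow> complex) \<Rightarrow> complex \<Rightarrow> complex ^'g \<Rightarrow> complex" where
  "hecke_V p k \<phi> \<tau> z = \<phi> (of_nat p * \<tau>) (of_nat p *s z)
     + of_nat p powi (- k) * (\<Sum>t<p. \<phi> ((\<tau> + of_nat t) / of_nat p) z)"

lemma sum_hecke_reps:
  assumes "prime p"
  shows "(\<Sum>\<rho>\<in>hecke_reps p. f \<rho>) = f (int p, 0, 0, 1) + (\<Sum>t<p. f (1, int t, 0, int p))"
proof -
  have "p \<noteq> 1" using assms by auto
  hence "(int p, 0, 0, 1) \<notin> (\<lambda>t. (1 :: int, int t, 0 :: int, int p)) ` {..<p}" by auto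
  moreover have "inj_on (\<lambda>t. (1 :: int, int t, 0 :: int, int p)) {..<p}" by (auto simp: inj_on_def)
  ultimately show ?thesis by (simp add: hecke_reps_def sum.reindex)
qed

text \<open>Unfolding the operator produces terms at \<open>M \<rho>\<close>.
  \<open>hecke_exchange\<close> and invariance under translation turn them into terms at
  \<open>\<rho> M\<close>, where \<rho> acts on the data instead of the variables.\<close>

lemma hecke_has_sum:
  fixes m :: "real ^'g ^'g"
  assumes m: "jacobi_datum m n r" and k: "k > int CARD('g) + 2" and p: "prime p" and \<tau>: "Im \<tau> > 0"
  shows "((\<lambda>((M, l), \<rho>). jterm k p m n r (qmul \<rho> M) l \<tau> z)
      has_sum hecke_V p k (jacobi_poincare k m n r) \<tau> z) ((sl2_reps \<times> UNIV) \<times> hecke_reps p)"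
proof -
  define f where "f = (\<lambda>A l. jterm k p m n r A l \<tau> z)"
  define P where "P = jacobi_poincare k m n r"
  \<comment> \<open>The contribution of \<rho> to the operator; for \<rho> of the shape
    \<open>(1, t, 0, p)\<close>, the second entry recovers \<open>t\<close>.\<close>
  define S :: "quad \<Rightarrow> complex" where
    "S = (\<lambda>\<rho>. if \<rho> = (int p, 0, 0, 1) then P (of_nat p * \<tau>) (of_nat p *s z)
              else of_nat p powi (- k) * P ((\<tau> + of_int (fst (snd \<rho>))) / of_nat p) z)"
  have p0: "p > 0" and p1: "p \<noteq> 1" using p prime_gt_0_nat by auto
  have sum_S: "(\<Sum>\<rho>\<in>hecke_reps p. S \<rho>) = hecke_V p k P \<tau> z"
    unfolding sum_hecke_reps[OF p] hecke_V_def using p1 by (simp add: S_def sum_distrib_left)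
  have S: "((\<lambda>(M, l). f (qmul M \<rho>) l) has_sum S \<rho>) (sl2_reps \<times> UNIV)" if \<rho>: "\<rho> \<in> hecke_reps p" for \<rho>
    using \<rho>
  proof (cases rule: hecke_reps_cases)
    case 1
    have "Im (of_nat p * \<tau>) > 0" using \<tau> p0 by simp
    from jacobi_poincare_has_sum[OF m k this, of "of_nat p *s z"]
    have "((\<lambda>(M, l). jterm k 1 m n r M l (of_nat p * \<tau>) (of_nat p *s z)) has_sum S \<rho>) (sl2_reps \<times> UNIV)"
      by (simp add: S_def P_def 1)
    also have "(\<lambda>(M, l). jterm k 1 m n r M l (of_nat p * \<tau>) (of_nat p *s z)) = (\<lambda>(M, l). f (qmul M \<rho>) l)"
      by (auto simp: fun_eq_iff jterm_at_upper_left[OF p0] f_def 1 mult.commute[of _ "int p"]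
               simp del: jterm.simps One_nat_def)
    finally show ?thesis .
  next
    case (2 t)
    have "Im ((\<tau> + of_nat t) / of_nat p) > 0" using \<tau> p0 by simp
    from has_sum_cmult_right[OF jacobi_poincare_has_sum[OF m k this, of z], of "of_nat p powi (- k)"]
    have "((\<lambda>(M, l). of_nat p powi (- k) * jterm k 1 m n r M l ((\<tau> + of_nat t) / of_nat p) z)
        has_sum S \<rho>) (sl2_reps \<times> UNIV)"
      using p1 by (simp add: S_def P_def 2 case_prod_unfold)
    also have "(\<lambda>(M, l). of_nat p powi (- k) * jterm k 1 m n r M l ((\<tau> + of_nat t) / of_nat p) z)
        = (\<lambda>(M, l). f (qmul M \<rho>) l)"
      by (auto simp: fun_eq_iff jterm_at_lower_right[OF p0] f_def 2 mult.commute[of _ "int p"]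
               simp del: jterm.simps One_nat_def)
    finally show ?thesis .
  qed
  have "((\<lambda>(\<rho>, (M, l)). f (qmul M \<rho>) l) has_sum hecke_V p k P \<tau> z) (hecke_reps p \<times> (sl2_reps \<times> UNIV))"
    using has_sum_finite_times[of "hecke_reps p" "\<lambda>\<rho> (M, l). f (qmul M \<rho>) l" _ S, OF finite_hecke_reps S]
    by (simp add: sum_S)
  also have "?this \<longleftrightarrow> ((\<lambda>((\<rho>, M), l). f (qmul M \<rho>) l) has_sum hecke_V p k P \<tau> z)
      ((hecke_reps p \<times> sl2_reps) \<times> UNIV)"
    by (rule has_sum_reindex_bij_witness[of _ "\<lambda>((\<rho>, M), l). (\<rho>, (M, l))" "\<lambda>(\<rho>, (M, l)). ((\<rho>, M), l)"]) auto
  finally have sum1: "((\<lambda>((\<rho>, M), l). f (qmul M \<rho>) l) has_sum hecke_V p k P \<tau> z)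
      ((hecke_reps p \<times> sl2_reps) \<times> UNIV)" .
  obtain h where h: "bij_betw h (hecke_reps p \<times> sl2_reps) (hecke_reps p \<times> sl2_reps)"
    "\<And>\<rho> M. \<rho> \<in> hecke_reps p \<Longrightarrow> M \<in> sl2_reps \<Longrightarrow>
       \<exists>s. qmul M \<rho> = translate s (qmul (fst (h (\<rho>, M))) (snd (h (\<rho>, M))))"
    using hecke_exchange[OF p] by blast
  have bij: "bij_betw (map_prod h id) ((hecke_reps p \<times> sl2_reps) \<times> UNIV)
      ((hecke_reps p \<times> sl2_reps) \<times> (UNIV :: (int ^'g) set))"
    using h(1) by (intro bij_betw_map_prod) auto
  have "f (qmul M \<rho>) l = f (qmul (fst (h (\<rho>, M))) (snd (h (\<rho>, M)))) l"
    if \<rho>: "\<rho> \<in> hecke_reps p" and M: "M \<in> sl2_reps" for \<rho> M l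
  proof -
    obtain s where s: "qmul M \<rho> = translate s (qmul (fst (h (\<rho>, M))) (snd (h (\<rho>, M))))"
      using h(2) \<rho> M by blast
    obtain a b c d where G: "qmul (fst (h (\<rho>, M))) (snd (h (\<rho>, M))) = (a, b, c, d)"
      using prod_cases4 by blast
    have "qdet M = 1" using M sl2_reps_det by (cases M) auto
    hence "qdet (qmul M \<rho>) = int p" by (simp add: qdet_mult qdet_hecke_reps \<rho>)
    hence "qdet (a, b, c, d) = int p" unfolding s G qdet_translate .
    hence "(c, d) \<noteq> (0, 0)" using p0 by auto
    from jterm_translate[OF jacobi_datumD(1,2)[OF m] this \<tau>] show ?thesis
      unfolding f_def s G by simp
  qed
  hence inv: "(\<lambda>((\<rho>, M), l). f (qmul M \<rho>) l) x
      = (\<lambda>((\<rho>, M), l). f (qmul \<rho> M) l) (map_prod h id x)"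
    if "x \<in> (hecke_reps p \<times> sl2_reps) \<times> UNIV" for x
    using that unfolding case_prod_unfold map_prod_def mem_Times_iff by (simp add: prod_eq_iff)
  have "((\<lambda>x. (\<lambda>((\<rho>, M), l). f (qmul \<rho> M) l) (map_prod h id x)) has_sum hecke_V p k P \<tau> z)
      ((hecke_reps p \<times> sl2_reps) \<times> UNIV)"
    by (rule iffD1[OF has_sum_cong sum1]) (rule inv)
  hence "((\<lambda>((\<rho>, M), l). f (qmul \<rho> M) l) has_sum hecke_V p k P \<tau> z) ((hecke_reps p \<times> sl2_reps) \<times> UNIV)"
    unfolding has_sum_reindex_bij_betw[OF bij, of "\<lambda>((\<rho>, M), l). f (qmul \<rho> M) l"] .
  also have "?this \<longleftrightarrow> ((\<lambda>((M, l), \<rho>). f (qmul \<rho> M) l) has_sum hecke_V p k P \<tau> z)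
      ((sl2_reps \<times> UNIV) \<times> hecke_reps p)"
    by (rule has_sum_reindex_bij_witness[of _ "\<lambda>((M, l), \<rho>). ((\<rho>, M), l)" "\<lambda>((\<rho>, M), l). ((M, l), \<rho>)"]) auto
  finally show ?thesis by (simp add: f_def P_def)
qed

text \<open>The representative \<open>(p, 0, 0, 1)\<close> accounts exactly for the series of index
  \<open>p m\<close>; what remains is the character sum over \<open>t\<close>.\<close>

lemma hecke_V_poincare_remainder:
  fixes m :: "real ^'g ^'g"
  assumes m: "jacobi_datum m n r" and k: "k > int CARD('g) + 2" and p: "prime p" and \<tau>: "Im \<tau> > 0"
  shows "((\<lambda>(M, l). \<Sum>t<p. jterm k p m n r (qmul (1, int t, 0, int p) M) l \<tau> z)
      has_sum (hecke_V p k (jacobi_poincare k m n r) \<tau> z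
        - jacobi_poincare k (real p *\<^sub>R m) (p * n) (int p *s r) \<tau> z)) (sl2_reps \<times> UNIV)"
proof -
  have p0: "p > 0" using p prime_gt_0_nat by auto
  define g where "g = (\<lambda>(M, l). \<Sum>t<p. jterm k p m n r (qmul (1, int t, 0, int p) M) l \<tau> z)"
  have "((\<lambda>x. \<Sum>\<rho>\<in>hecke_reps p. case x of (M, l) \<Rightarrow> jterm k p m n r (qmul \<rho> M) l \<tau> z)
      has_sum hecke_V p k (jacobi_poincare k m n r) \<tau> z) (sl2_reps \<times> UNIV)"
    by (rule has_sum_SigmaD[OF hecke_has_sum[OF m k p \<tau>, of z]])
       (auto simp: case_prod_unfold finite_hecke_reps intro!: has_sum_finiteI)
  moreover have "((\<lambda>(M, l). jterm k 1 (real p *\<^sub>R m) (p * n) (int p *s r) M l \<tau> z)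
      has_sum jacobi_poincare k (real p *\<^sub>R m) (p * n) (int p *s r) \<tau> z) (sl2_reps \<times> UNIV)"
    by (intro jacobi_poincare_has_sum jacobi_datum_scale m k \<tau> p0)
  ultimately have "((\<lambda>x. (\<Sum>\<rho>\<in>hecke_reps p. case x of (M, l) \<Rightarrow> jterm k p m n r (qmul \<rho> M) l \<tau> z)
        + - (case x of (M, l) \<Rightarrow> jterm k 1 (real p *\<^sub>R m) (p * n) (int p *s r) M l \<tau> z))
      has_sum (hecke_V p k (jacobi_poincare k m n r) \<tau> z
        + - jacobi_poincare k (real p *\<^sub>R m) (p * n) (int p *s r) \<tau> z)) (sl2_reps \<times> UNIV)"
    by (intro has_sum_add) (simp_all add: has_sum_uminus)
  also have "(\<lambda>x. (\<Sum>\<rho>\<in>hecke_reps p. case x of (M, l) \<Rightarrow> jterm k p m n r (qmul \<rho> M) l \<tau> z)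
        + - (case x of (M, l) \<Rightarrow> jterm k 1 (real p *\<^sub>R m) (p * n) (int p *s r) M l \<tau> z)) = g"
    unfolding sum_hecke_reps[OF p] g_def
    by (auto simp: fun_eq_iff jterm_upper_left simp del: jterm.simps One_nat_def)
  finally show ?thesis by (simp add: g_def)
qed

lemma e_of_nat_mult: "e (of_nat t * x) = e x ^ t"
  by (induction t) (simp_all add: e_add distrib_right, simp add: e_def)

lemma sum_roots_of_unity:
  assumes p: "p > 0" and q: "\<not> int p dvd q"
  shows "(\<Sum>t<p. e (of_int q * of_nat t / of_nat p)) = 0"
proof -
  define w where "w = e (of_int q / of_nat p)"
  have "w \<noteq> 1"
  proof
    assume "w = 1"
    then obtain j :: int where "Im (2 * of_real pi * \<i> * (of_int q / of_nat p)) = of_int (2 * j) * pi"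
      unfolding w_def e_def exp_eq_1 by blast
    hence "(2 * pi) * (of_int q / of_nat p) = (2 * pi) * of_int j" by simp
    hence "of_int q / of_nat p = (of_int j :: real)" unfolding mult_cancel_left by simp
    hence "real_of_int q = real_of_int (int p * j)" using p by (simp add: field_simps)
    hence "q = int p * j" by linarith
    thus False using q by simp
  qed
  have "w ^ p = e (of_nat p * (of_int q / of_nat p))" by (simp only: w_def e_of_nat_mult)
  also have "\<dots> = e (of_int q)" using p by simp
  also have "\<dots> = 1" by (rule e_Ints) simp
  finally have "w ^ p = 1" .
  have "(\<Sum>t<p. e (of_int q * of_nat t / of_nat p)) = (\<Sum>t<p. w ^ t)"
    by (simp add: w_def e_of_nat_mult[symmetric] mult.commute)
  also have "\<dots> = 0" using \<open>w \<noteq> 1\<close> \<open>w ^ p = 1\<close> by (simp add: geometric_sum)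
  finally show ?thesis .
qed

text \<open>When \<open>p\<close> never divides the value of \<open>qpoly\<close>, each inner sum
  over \<open>t\<close> is a full sum of powers of a nontrivial p-th root of unity.\<close>

theorem hecke_V_poincare_base:
  fixes m :: "real ^'g ^'g"
  assumes m: "jacobi_datum m n r" and k: "k > int CARD('g) + 2" and p: "prime p" and \<tau>: "Im \<tau> > 0"
    and q: "\<And>l. \<exists>q. qpoly m n r (of_int_vec l) = of_int q \<and> \<not> int p dvd q"
  shows "hecke_V p k (jacobi_poincare k m n r) \<tau> z
    = jacobi_poincare k (real p *\<^sub>R m) (p * n) (int p *s r) \<tau> z"
proof -
  have p0: "p > 0" using p prime_gt_0_nat by auto
  have "(\<Sum>t<p. jterm k p m n r (qmul (1, int t, 0, int p) (a, b, c, d)) l \<tau> z) = 0"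
    if "(a, b, c, d) \<in> sl2_reps" for a b c d l
  proof -
    obtain q where q: "qpoly m n r (of_int_vec l) = of_int q" "\<not> int p dvd q" using q by blast
    have J: "of_int c * \<tau> + of_int d \<noteq> 0"
      using automorphy_factor_nonzero[OF \<tau> sl2_reps_bottom_nonzero[OF that]] .
    have "jterm k p m n r (qmul (1, int t, 0, int p) (a, b, c, d)) l \<tau> z
      = jterm k p m n r (a + int t * c, b + int t * d, int p * c, int p * d) l \<tau> z" for t by simp
    thus ?thesis
      unfolding jterm_lower_right[OF p0 J] q(1)
      by (simp only: sum_distrib_right[symmetric] sum_distrib_left[symmetric]
            sum_roots_of_unity[OF p0 q(2)] mult_zero_right mult_zero_left)
  qed
  hence "((\<lambda>(M, l). \<Sum>t<p. jterm k p m n r (qmul (1, int t, 0, int p) M) l \<tau> z) has_sum 0) (sl2_reps \<times> UNIV)"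
    by (intro has_sum_0) auto
  from has_sum_unique[OF hecke_V_poincare_remainder[OF m k p \<tau>] this] show ?thesis by simp
qed

text \<open>Here \<open>p\<close> divides every value of the polynomial, so the roots of unity are
  all 1. The \<open>p\<close> equal terms, each with factor \<open>p^(-k)\<close>, add up to the
  factor \<open>p^(1-k)\<close>, and the rescaled exponent is the old one at
  \<open>p z\<close>.\<close>

theorem hecke_V_poincare_step:
  fixes m :: "real ^'g ^'g"
  assumes m: "jacobi_datum m n r" and k: "k > int CARD('g) + 2" and p: "prime p" and \<tau>: "Im \<tau> > 0"
  shows "hecke_V p k (jacobi_poincare k (real p *\<^sub>R m) (p * n) (int p *s r)) \<tau> z
    = jacobi_poincare k (real p *\<^sub>R (real p *\<^sub>R m)) (p * (p * n)) (int p *s (int p *s r)) \<tau> z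
      + of_nat p powi (1 - k) * jacobi_poincare k m n r \<tau> (of_nat p *s z)"
proof -
  have p0: "p > 0" using p prime_gt_0_nat by auto
  let ?f = "\<lambda>M l t. jterm k p (real p *\<^sub>R m) (p * n) (int p *s r) (qmul (1, int t, 0, int p) M) l \<tau> z"
  have f: "?f (a, b, c, d) l t = of_nat p powi (- k) * jterm k 1 m n r (a, b, c, d) l \<tau> (of_nat p *s z)"
    if "(a, b, c, d) \<in> sl2_reps" for a b c d l t
  proof -
    have J: "of_int c * \<tau> + of_int d \<noteq> 0"
      using automorphy_factor_nonzero[OF \<tau> sl2_reps_bottom_nonzero[OF that]] .
    have q: "qpoly (real p *\<^sub>R m) (p * n) (int p *s r) (of_int_vec l) = of_nat p * qpoly m n r (of_int_vec l)"
      by (simp add: qpoly_def qform_def bilin_cmat_scaleR linform_smult distrib_left)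
    have "qpoly m n r (of_int_vec l) * of_nat t \<in> \<int>"
      using qpoly_Ints[OF jacobi_datumD(1,2)[OF m]] by (intro Ints_mult) auto
    hence e: "e (of_nat p * qpoly m n r (of_int_vec l) * of_nat t / of_nat p) = 1"
      using p0 by (simp add: e_Ints)
    have "?f (a, b, c, d) l t = jterm k p (real p *\<^sub>R m) (p * n) (int p *s r)
        (a + int t * c, b + int t * d, int p * c, int p * d) l \<tau> z" by simp
    thus ?thesis
      unfolding jterm_lower_right[OF p0 J] q e using p0
      by (simp add: qform_def bilin_cmat_scaleR linform_smult linform_scale bilin_scale_left
            bilin_scale_right power2_eq_square algebra_simps)
  qed
  have "of_nat p * of_nat p powi (- k) = (of_nat p powi (1 - k) :: complex)"
    using p0 by (simp add: power_int_diff power_int_minus divide_inverse)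
  hence "(\<Sum>t<p. ?f (a, b, c, d) l t)
      = of_nat p powi (1 - k) * jterm k 1 m n r (a, b, c, d) l \<tau> (of_nat p *s z)"
    if "(a, b, c, d) \<in> sl2_reps" for a b c d l
    unfolding f[OF that] by (simp add: mult.assoc[symmetric] del: jterm.simps)
  hence "((\<lambda>(M, l). \<Sum>t<p. ?f M l t) has_sum
        (of_nat p powi (1 - k) * jacobi_poincare k m n r \<tau> (of_nat p *s z))) (sl2_reps \<times> UNIV)
    \<longleftrightarrow> ((\<lambda>x. of_nat p powi (1 - k) * (case x of (M, l) \<Rightarrow> jterm k 1 m n r M l \<tau> (of_nat p *s z))) has_sum
        (of_nat p powi (1 - k) * jacobi_poincare k m n r \<tau> (of_nat p *s z))) (sl2_reps \<times> UNIV)"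
    by (intro has_sum_cong) (auto simp del: jterm.simps)
  also have "\<dots>" by (intro has_sum_cmult_right jacobi_poincare_has_sum m k \<tau>)
  finally have "((\<lambda>(M, l). \<Sum>t<p. ?f M l t) has_sum
        (of_nat p powi (1 - k) * jacobi_poincare k m n r \<tau> (of_nat p *s z))) (sl2_reps \<times> UNIV)" .
  from has_sum_unique[OF hecke_V_poincare_remainder[OF jacobi_datum_scale[OF m p0] k p \<tau>] this]
  show ?thesis by (simp add: algebra_simps)
qed

section \<open>Averaging over residue classes\<close>

text \<open>The coordinatewise round trips between \<open>(x, y, l)\<close> and
  \<open>(v, w)\<close>, where \<open>v = N l + (d x - c y)\<close> and
  \<open>w = (a y - b x) mod N\<close>. Going back, \<open>(x, y)\<close> is \<open>(v, w)\<close>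
  times the matrix modulo \<open>N\<close>, and \<open>l\<close> is the exact quotient left
  over.\<close>

lemma residue_exchange:
  fixes N a b c d :: int
  assumes N: "N > 0" and det: "a * d - b * c = 1"
  shows "0 \<le> x \<Longrightarrow> x < N \<Longrightarrow> (a * (N * l + (d * x - c * y)) + c * ((a * y - b * x) mod N)) mod N = x"
    and "0 \<le> y \<Longrightarrow> y < N \<Longrightarrow> (b * (N * l + (d * x - c * y)) + d * ((a * y - b * x) mod N)) mod N = y"
    and "0 \<le> w \<Longrightarrow> w < N \<Longrightarrow>
      (a * ((b * v + d * w) mod N) - b * ((a * v + c * w) mod N)) mod N = w"
    and "N * ((v - (d * ((a * v + c * w) mod N) - c * ((b * v + d * w) mod N))) div N)
        + (d * ((a * v + c * w) mod N) - c * ((b * v + d * w) mod N)) = v"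
proof -
  have mod1: "(X + u * (Y mod N)) mod N = (X + u * Y) mod N" for X Y u
    by (metis mod_add_right_eq mod_mult_right_eq)
  have mod2: "(u * (X mod N) - w * (Y mod N)) mod N = (u * X - w * Y) mod N" for X Y u w
    by (metis mod_diff_eq mod_mult_right_eq)
  have mod3: "(v - (u * (X mod N) - w * (Y mod N))) mod N = (v - (u * X - w * Y)) mod N" for X Y u w
    by (metis mod2 mod_diff_right_eq)
  have det_mult: "a * d * X - b * c * X = X" for X using det by (metis left_diff_distrib mult_1)
  {
    assume x: "0 \<le> x" "x < N"
    have "(a * (N * l + (d * x - c * y)) + c * ((a * y - b * x) mod N)) mod N
        = (a * (N * l + (d * x - c * y)) + c * (a * y - b * x)) mod N"
      by (rule mod1)
    also have "a * (N * l + (d * x - c * y)) + c * (a * y - b * x) = x + N * (a * l)"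
      using det_mult[of x] by (simp add: algebra_simps)
    finally show "(a * (N * l + (d * x - c * y)) + c * ((a * y - b * x) mod N)) mod N = x"
      using x by simp
  }
  {
    assume y: "0 \<le> y" "y < N"
    have "(b * (N * l + (d * x - c * y)) + d * ((a * y - b * x) mod N)) mod N
        = (b * (N * l + (d * x - c * y)) + d * (a * y - b * x)) mod N"
      by (rule mod1)
    also have "b * (N * l + (d * x - c * y)) + d * (a * y - b * x) = y + N * (b * l)"
      using det_mult[of y] by (simp add: algebra_simps)
    finally show "(b * (N * l + (d * x - c * y)) + d * ((a * y - b * x) mod N)) mod N = y"
      using y by simp
  }
  {
    assume w: "0 \<le> w" "w < N"
    have "(a * ((b * v + d * w) mod N) - b * ((a * v + c * w) mod N)) mod N
        = (a * (b * v + d * w) - b * (a * v + c * w)) mod N"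
      by (rule mod2)
    also have "a * (b * v + d * w) - b * (a * v + c * w) = w"
      using det_mult[of w] by (simp add: algebra_simps)
    finally show "(a * ((b * v + d * w) mod N) - b * ((a * v + c * w) mod N)) mod N = w"
      using w by simp
  }
  have "(v - (d * ((a * v + c * w) mod N) - c * ((b * v + d * w) mod N))) mod N
      = (v - (d * (a * v + c * w) - c * (b * v + d * w))) mod N"
    by (rule mod3)
  also have "v - (d * (a * v + c * w) - c * (b * v + d * w)) = 0"
    using det_mult[of v] by (simp add: algebra_simps)
  finally show "N * ((v - (d * ((a * v + c * w) mod N) - c * ((b * v + d * w) mod N))) div N)
        + (d * ((a * v + c * w) mod N) - c * ((b * v + d * w) mod N)) = v"
    by (simp add: mult_div_mod_eq minus_mod_eq_mult_div[symmetric])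
qed

definition residue_box :: "int \<Rightarrow> (int ^'g) set" where
  "residue_box N = {v. \<forall>i. 0 \<le> v $ i \<and> v $ i < N}"

lemma finite_residue_box: "finite (residue_box N :: (int ^'g) set)"
proof -
  have "residue_box N = vec_lambda ` (PiE UNIV (\<lambda>_::'g. {0..<N}))"
  proof (intro equalityI subsetI)
    fix v :: "int ^'g" assume "v \<in> residue_box N"
    thus "v \<in> vec_lambda ` (PiE UNIV (\<lambda>_::'g. {0..<N}))"
      by (intro image_eqI[of _ _ "vec_nth v"]) (auto simp: residue_box_def)
  qed (auto simp: residue_box_def PiE_iff)
  thus ?thesis by (simp add: finite_PiE)
qed

text \<open>After \<open>z\<close> is divided by \<open>N\<close>, the vanishing series runs over
  \<open>N\<close> times the lattice only. Translating by all pairs of residue vectors reaches every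
  lattice vector equally often, so a positive multiple of the full series vanishes.\<close>

lemma poincare_zero_descent:
  fixes m :: "real ^'g ^'g"
  assumes m: "jacobi_datum m n r" and k: "k > int CARD('g) + 2" and N: "N > 0"
    and zero: "\<And>\<tau> z. Im \<tau> > 0 \<Longrightarrow> jacobi_poincare k (real N ^ 2 *\<^sub>R m) n (int N *s r) \<tau> z = 0"
    and \<tau>: "Im \<tau> > 0"
  shows "jacobi_poincare k m n r \<tau> z = 0"
proof -
  note sym = jacobi_datumD(1,2)[OF m]
  let ?B = "residue_box (int N) :: (int ^'g) set"
  define s :: "quad \<Rightarrow> int ^'g \<Rightarrow> (int ^'g) \<times> (int ^'g) \<Rightarrow> int ^'g"
    where "s = (\<lambda>(a, b, c, d) l (x, y). int N *s l + (d *s x - c *s y))"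
  \<comment> \<open>For a fixed translation \<open>(x, y)\<close>, the factor \<open>C\<close> moves
    the evaluation point back to \<open>z\<close> and shifts \<open>N l\<close> by the first
    component of \<open>(x, y)\<close> times the inverse matrix.\<close>
  have shifted: "((\<lambda>(M, l). jterm k 1 m n r M (s M l X) \<tau> z) has_sum 0) (sl2_reps \<times> UNIV)" for X
  proof -
    obtain x y where X: "X = (x, y)" by (cases X)
    define z' where "z' = z + \<tau> *s of_int_vec x + of_int_vec y"
    define C where "C = e (qform (cmat m) (of_int_vec x) * \<tau> + 2 * bilin (cmat m) (of_int_vec x) z)"
    let ?z = "of_real (1 / real N) *s z' :: complex ^'g"
    have "((\<lambda>(M, l). jterm k 1 (real N ^ 2 *\<^sub>R m) n (int N *s r) M l \<tau> ?z) has_sum 0) (sl2_reps \<times> UNIV)"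
      using jacobi_poincare_has_sum[OF jacobi_datum_square[OF m N] k \<tau>, of ?z] zero[OF \<tau>, of ?z] by simp
    hence "((\<lambda>x. C * (case x of (M, l) \<Rightarrow> jterm k 1 (real N ^ 2 *\<^sub>R m) n (int N *s r) M l \<tau> ?z)) has_sum C * 0)
        (sl2_reps \<times> UNIV)" by (rule has_sum_cmult_right)
    hence *: "((\<lambda>x. C * (case x of (M, l) \<Rightarrow> jterm k 1 (real N ^ 2 *\<^sub>R m) n (int N *s r) M l \<tau> ?z)) has_sum 0)
        (sl2_reps \<times> UNIV)" by simp
    show ?thesis
    proof (rule iffD1[OF has_sum_cong *])
      fix Y :: "quad \<times> (int ^'g)" assume "Y \<in> sl2_reps \<times> UNIV"
      then obtain a b c d l where Y: "Y = ((a, b, c, d), l)" and M: "(a, b, c, d) \<in> sl2_reps"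
        by (cases Y) auto
      have det: "a * d - b * c = 1" using sl2_reps_det[OF M] .
      have uv: "a * (d * u - c * v) + c * (a * v - b * u) = u"
           "b * (d * u - c * v) + d * (a * v - b * u) = v" for u v
        using det by algebra+
      have xy: "a *s (d *s x - c *s y) + c *s (a *s y - b *s x) = x"
                "b *s (d *s x - c *s y) + d *s (a *s y - b *s x) = y"
        by (simp_all only: vec_eq_iff vector_add_component vector_minus_component
              vector_smult_component uv simp_thms)
      have "C * jterm k 1 (real N ^ 2 *\<^sub>R m) n (int N *s r) (a, b, c, d) l \<tau> ?z
          = C * jterm k 1 m n r (a, b, c, d) (int N *s l) \<tau> z'"
        by (simp only: jterm_scaled[OF N N])
      also have "\<dots> = jterm k 1 m n r (a, b, c, d) (int N *s l + (d *s x - c *s y)) \<tau> z"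
        using jterm_slash[OF sym det \<tau>, where x = "d *s x - c *s y" and y = "a *s y - b *s x"]
        unfolding xy C_def z'_def by blast
      finally show "C * (case Y of (M, l) \<Rightarrow> jterm k 1 (real N ^ 2 *\<^sub>R m) n (int N *s r) M l \<tau> ?z)
          = (case Y of (M, l) \<Rightarrow> jterm k 1 m n r M (s M l X) \<tau> z)"
        by (simp add: Y s_def X del: jterm.simps)
    qed
  qed
  have "((\<lambda>(X, (M, l)). jterm k 1 m n r M (s M l X) \<tau> z) has_sum 0) ((?B \<times> ?B) \<times> (sl2_reps \<times> UNIV))"
    using has_sum_finite_times[of "?B \<times> ?B" "\<lambda>X (M, l). jterm k 1 m n r M (s M l X) \<tau> z" _ "\<lambda>_. 0", OF _ shifted]
    by (simp add: finite_residue_box)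
  also have "?this \<longleftrightarrow> ((\<lambda>(w, (M, l)). jterm k 1 m n r M l \<tau> z) has_sum 0) (?B \<times> (sl2_reps \<times> UNIV))"
  \<comment> \<open>For each matrix, the pairs of a translation and a vector \<open>l\<close>
    correspond to the pairs of a free residue \<open>w\<close> and an arbitrary vector; the term
    ignores \<open>w\<close>.\<close>
  proof (rule has_sum_reindex_bij_witness[where
        j = "\<lambda>((x, y), ((a, b, c, d), l)). (\<chi> i. (a * y $ i - b * x $ i) mod int N,
               ((a, b, c, d), s (a, b, c, d) l (x, y)))"
        and i = "\<lambda>(w, ((a, b, c, d), v)).
            ((\<chi> i. (a * v $ i + c * w $ i) mod int N, \<chi> i. (b * v $ i + d * w $ i) mod int N),
             ((a, b, c, d), \<chi> i. (v $ i - (d * ((a * v $ i + c * w $ i) mod int N)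
                  - c * ((b * v $ i + d * w $ i) mod int N))) div int N))"])
  qed (use N residue_exchange[of "int N"] sl2_reps_det in
        \<open>auto simp: residue_box_def s_def vec_eq_iff simp del: jterm.simps\<close>)
  finally have 1: "((\<lambda>(w, (M, l)). jterm k 1 m n r M l \<tau> z) has_sum 0) (?B \<times> (sl2_reps \<times> UNIV))" .
  have "((\<lambda>(w, (M, l)). jterm k 1 m n r M l \<tau> z) has_sum (\<Sum>w\<in>?B. jacobi_poincare k m n r \<tau> z))
      (?B \<times> (sl2_reps \<times> UNIV))"
    using has_sum_finite_times[of ?B "\<lambda>w (M, l). jterm k 1 m n r M l \<tau> z", OF finite_residue_box
        jacobi_poincare_has_sum[OF m k \<tau>]] .
  from has_sum_unique[OF 1 this] have "of_nat (card ?B) * jacobi_poincare k m n r \<tau> z = 0" by simp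
  moreover have "0 \<in> ?B" using N by (simp add: residue_box_def)
  hence "card ?B \<noteq> 0" by (metis card_eq_0_iff empty_iff finite_residue_box)
  ultimately show ?thesis by simp
qed

section \<open>The recursion\<close>

text \<open>The operator commutes with scaling \<open>z\<close>. With \<open>C = 0\<close> this also
  shows that it annihilates functions vanishing on the upper half-plane.\<close>

lemma hecke_V_scaled:
  assumes \<phi>: "\<And>\<tau> z. Im \<tau> > 0 \<Longrightarrow> \<phi> \<tau> z = C * \<psi> \<tau> (s *s z)" and p: "p > 0" and \<tau>: "Im \<tau> > 0"
  shows "hecke_V p k \<phi> \<tau> z = C * hecke_V p k \<psi> \<tau> (s *s z)"
proof -
  have "\<phi> (of_nat p * \<tau>) (of_nat p *s z) = C * \<psi> (of_nat p * \<tau>) (of_nat p *s (s *s z))"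
    using p \<tau> by (simp add: \<phi> mult.commute)
  moreover have "\<phi> ((\<tau> + of_nat t) / of_nat p) z = C * \<psi> ((\<tau> + of_nat t) / of_nat p) (s *s z)" for t
    using p \<tau> by (intro \<phi>) simp
  ultimately show ?thesis
    by (simp add: hecke_V_def distrib_left sum_distrib_left mult_ac)
qed

text \<open>A solution of the three-term recursion which vanishes at \<open>0\<close> and at \<open>N\<close> is antisymmetric
  about \<open>N\<close> up to the operators \<open>\<phi>(\<tau>, z) \<mapsto> \<phi>(\<tau>, pz)\<close>, which commute with \<open>hecke_V\<close>. So it vanishes
  at \<open>2N\<close>, and the next term comes back to the first.\<close>

lemma hecke_recursion_reflect:
  fixes y :: "nat \<Rightarrow> complex \<Rightarrow> complex ^'g \<Rightarrow> complex"
  assumes p: "p > 0"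
    and rec: "\<And>j \<tau> z. Im \<tau> > 0 \<Longrightarrow>
      hecke_V p k (y (Suc j)) \<tau> z = y (Suc (Suc j)) \<tau> z + c * y j \<tau> (of_nat p *s z)"
    and y0: "\<And>\<tau> z. Im \<tau> > 0 \<Longrightarrow> y 0 \<tau> z = 0"
    and yN: "\<And>\<tau> z. Im \<tau> > 0 \<Longrightarrow> y N \<tau> z = 0"
    and N: "N > 0" and \<tau>: "Im \<tau> > 0"
  shows "y (2 * N + 1) \<tau> z = c ^ N * y 1 \<tau> (of_nat (p ^ N) *s z)"
proof -
  have reflect: "\<forall>\<tau> z. Im \<tau> > 0 \<longrightarrow> y (N + i) \<tau> z = - (c ^ i) * y (N - i) \<tau> (of_nat (p ^ i) *s z)"
    if "i \<le> N" for i
    using that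
  proof (induction i rule: less_induct)
    case (less i)
    show ?case
    proof (cases i)
      case 0
      thus ?thesis by (simp add: yN)
    next
      case (Suc i')
      show ?thesis
      proof (cases i')
        case 0
        obtain N' where N': "N = Suc N'" using N by (cases N) auto
        have "hecke_V p k (y N) \<tau> z = 0" if "Im \<tau> > 0" for \<tau> z
          using hecke_V_scaled[of "y N" 0 "y N" 1 p \<tau>] yN p that by simp
        thus ?thesis using rec[of _ N'] by (simp add: Suc 0 N' eq_neg_iff_add_eq_0)
      next
        case (Suc i'')
        note i = \<open>i = Suc i'\<close> Suc
        define j where "j = N - i"
        have j: "N = j + i" using less.prems by (simp add: j_def)
        show ?thesis
        proof (intro allI impI)
          fix \<tau> :: complex and z :: "complex ^'g" assume \<tau>: "Im \<tau> > 0"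
          \<comment> \<open>With \<open>N = j + i\<close>, the two preceding reflections land on
            \<open>j + 1\<close> and \<open>j + 2\<close>; the recursion at \<open>j + 1\<close>
            then leaves only \<open>y j\<close>.\<close>
          have IH1: "y (N + i') \<tau> z = - (c ^ i') * y (Suc j) \<tau> (of_nat (p ^ i') *s z)"
            if "Im \<tau> > 0" for \<tau> z
            using less.IH[of i'] less.prems that by (simp add: i j)
          have IH2: "y (N + i'') \<tau> (of_nat p *s z)
              = - (c ^ i'') * y (Suc (Suc j)) \<tau> (of_nat (p ^ i'') *s (of_nat p *s z))"
            using less.IH[of i''] less.prems \<tau> by (simp add: i j)
          have "y (N + i) \<tau> z = hecke_V p k (y (N + i')) \<tau> z - c * y (N + i'') \<tau> (of_nat p *s z)"
            using rec[OF \<tau>, of "N + i''" z] by (simp add: i)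
          also have "hecke_V p k (y (N + i')) \<tau> z
              = - (c ^ i') * hecke_V p k (y (Suc j)) \<tau> (of_nat (p ^ i') *s z)"
            by (rule hecke_V_scaled[of "y (N + i')" "- (c ^ i')" "y (Suc j)" "of_nat (p ^ i')", OF IH1 p \<tau>])
          also have "hecke_V p k (y (Suc j)) \<tau> (of_nat (p ^ i') *s z)
              = y (Suc (Suc j)) \<tau> (of_nat (p ^ i') *s z) + c * y j \<tau> (of_nat p *s (of_nat (p ^ i') *s z))"
            by (rule rec[OF \<tau>])
          also note IH2
          finally show "y (N + i) \<tau> z = - (c ^ i) * y (N - i) \<tau> (of_nat (p ^ i) *s z)"
            by (simp add: i j vector_smult_assoc algebra_simps)
        qed
      qed
    qed
  qed
  obtain N' where N': "N = Suc N'" using N by (cases N) auto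
  have "y (2 * N) \<tau> z = 0" if "Im \<tau> > 0" for \<tau> z
    using reflect[of N] that by (simp add: mult_2 y0)
  hence "hecke_V p k (y (2 * N)) \<tau> z = 0"
    using hecke_V_scaled[of "y (2 * N)" 0 "y N" 1 p \<tau>] p \<tau> by simp
  \<comment> \<open>The zero at \<open>2N\<close> reduces the next term to that at
    \<open>2N - 1\<close>, which reflects to \<open>y 1\<close>; the two minus signs cancel.\<close>
  hence "y (2 * N + 1) \<tau> z = - c * y (N + N') \<tau> (of_nat p *s z)"
    using rec[OF \<tau>, of "N + N'" z] by (simp add: N' mult_2 eq_neg_iff_add_eq_0)
  also have "\<dots> = c ^ N * y 1 \<tau> (of_nat (p ^ N) *s z)"
    using reflect[of N'] \<tau> by (simp add: N' vector_smult_assoc mult.commute)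
  finally show ?thesis .
qed

text \<open>Two consecutive zeros propagate. This serves both the given sequence and the one started
  from the series attached to \<open>(n, p^\<mu> r)\<close>.\<close>

lemma hecke_recursion_zero:
  fixes y :: "nat \<Rightarrow> complex \<Rightarrow> complex ^'g \<Rightarrow> complex"
  assumes p: "p > 0"
    and rec: "\<And>j \<tau> z. Im \<tau> > 0 \<Longrightarrow>
      hecke_V p k (y (Suc j)) \<tau> z = y (Suc (Suc j)) \<tau> z + c * y j \<tau> (of_nat p *s z)"
    and y0: "\<And>\<tau> z. Im \<tau> > 0 \<Longrightarrow> y 0 \<tau> z = 0"
    and y1: "\<And>\<tau> z. Im \<tau> > 0 \<Longrightarrow> y 1 \<tau> z = 0"
    and \<tau>: "Im \<tau> > 0"
  shows "y j \<tau> z = 0"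
  using \<tau>
proof (induction j arbitrary: \<tau> z rule: less_induct)
  case (less j)
  consider "j = 0" | "j = 1" | j' where "j = Suc (Suc j')"
    by (metis One_nat_def not0_implies_Suc)
  thus ?case
  proof cases
    case (3 j')
    have "hecke_V p k (y (Suc j')) \<tau> z = 0"
      using hecke_V_scaled[of "y (Suc j')" 0 "y 0" 1 p \<tau>] less 3 p by simp
    thus ?thesis using rec[OF less.prems, of j' z] less 3 by simp
  qed (use y0 y1 less.prems in auto)
qed

text \<open>Shifted by one, so that \<open>poincare_seq\<close> takes the value \<open>0\<close> at \<open>0\<close> and the recursion has no
  exceptional case.\<close>

definition poincare_seq ::
    "int \<Rightarrow> real ^'g ^'g \<Rightarrow> nat \<Rightarrow> int ^'g::finite \<Rightarrow> nat \<Rightarrow> nat \<Rightarrow> complex \<Rightarrow> complex ^'g \<Rightarrow> complex" where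
  "poincare_seq k m n r p j = (case j of 0 \<Rightarrow> (\<lambda>_ _. 0)
     | Suc j \<Rightarrow> jacobi_poincare k (real p ^ j *\<^sub>R m) (p ^ j * n) (int p ^ j *s r))"

text \<open>At \<open>j = 0\<close> the divisibility assumptions make every value of
  \<open>qpoly\<close> congruent to \<open>n\<close> modulo \<open>p\<close>, hence prime to
  \<open>p\<close>. For larger \<open>j\<close> the step identity applies to the data scaled by
  \<open>p^(j-1)\<close>.\<close>

lemma poincare_seq_recursion:
  fixes m :: "real ^'g ^'g"
  assumes m: "jacobi_datum m n r" and k: "k > int CARD('g) + 2" and p: "prime p" "odd p"
    and dvd: "divides_entries p m" "\<forall>i. int p dvd r $ i" "\<not> p dvd n" and \<tau>: "Im \<tau> > 0"
  shows "hecke_V p k (poincare_seq k m n r p (Suc j)) \<tau> z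
    = poincare_seq k m n r p (Suc (Suc j)) \<tau> z
      + of_nat p powi (1 - k) * poincare_seq k m n r p j \<tau> (of_nat p *s z)"
proof (cases j)
  case 0
  have "\<exists>q. qpoly m n r (of_int_vec l) = of_int q \<and> \<not> int p dvd q" for l
  proof -
    obtain v where v: "qform (cmat m) (of_int_vec l) = of_int v" "int p dvd v"
      using qform_of_int_vec[OF jacobi_datumD(1,2)[OF m]] p(2) dvd(1) by metis
    have "linform r (of_int_vec l) = (of_int (linform r l) :: complex)"
      by (simp add: linform_def of_int_vec_def)
    hence "qpoly m n r (of_int_vec l) = of_int (int n + linform r l + v)"
      by (simp add: qpoly_def v)
    moreover have "int p dvd linform r l"
      unfolding linform_def using dvd(2) by (intro dvd_sum) simp
    hence "\<not> int p dvd int n + linform r l + v"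
      using v(2) dvd(3) by (simp add: dvd_add_left_iff)
    ultimately show ?thesis by blast
  qed
  from hecke_V_poincare_base[OF m k p(1) \<tau> this] show ?thesis
    by (simp add: 0 poincare_seq_def)
next
  case (Suc j')
  have "p ^ j' > 0" using p(1) prime_gt_0_nat by simp
  from hecke_V_poincare_step[OF jacobi_datum_scale[OF m this] k p(1) \<tau>, of z] show ?thesis
    by (simp add: Suc poincare_seq_def vector_smult_assoc mult.assoc)
qed

theorem theorem1p3:
  fixes m :: "real ^'g ^'g" and n :: nat and r :: "int ^'g" and k :: int
    and p :: nat and \<mu> :: nat
  assumes "transpose m = m" and "positive_definite m" and "half_integral m"
    and "4 * real n > qform (matrix_inv m) (of_int_vec r)"
    and "k > int CARD('g) + 2"
    and "prime p" and "odd p" and "\<mu> \<ge> 1"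
    and "divides_entries p m" and "\<forall>i. int p dvd r $ i" and "\<not> p dvd n"
    and "not_identically_zero
           (jacobi_poincare k (real p ^ \<mu> *\<^sub>R m) (p ^ \<mu> * n) (int p ^ \<mu> *s r))"
  shows "not_identically_zero
           (jacobi_poincare k (real p ^ (\<mu> - 1) *\<^sub>R m) (p ^ (\<mu> - 1) * n) (int p ^ (\<mu> - 1) *s r))
       \<or> (not_identically_zero
            (jacobi_poincare k (real p ^ (2 * \<mu>) *\<^sub>R m) (p ^ (2 * \<mu>) * n) (int p ^ (2 * \<mu>) *s r))
          \<and> not_identically_zero
            (jacobi_poincare k (real p ^ (2 * \<mu>) *\<^sub>R m) n (int p ^ \<mu> *s r)))"
proof -
  note k = assms(5) and p = assms(6,7)
  have p0: "p > 0" and N0: "p ^ \<mu> > 0" using p prime_gt_0_nat by auto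
  have m: "jacobi_datum m n r"
    using assms(1,3) coercive_of_discriminant[OF assms(1,2,4)] by (simp add: jacobi_datum_def)
  define c where "c = (of_nat p powi (1 - k) :: complex)"
  have c: "c \<noteq> 0" using p0 by (simp add: c_def)
  define y where "y = poincare_seq k m n r p"
  have ySuc: "y (Suc j) = jacobi_poincare k (real p ^ j *\<^sub>R m) (p ^ j * n) (int p ^ j *s r)" for j
    by (simp add: y_def poincare_seq_def)
  have y0: "y 0 \<tau> z = 0" for \<tau> z by (simp add: y_def poincare_seq_def)
  note rec = poincare_seq_recursion[OF m k p assms(9-11), folded y_def c_def]
  have nz: "not_identically_zero (y (Suc \<mu>))" using assms(12) by (simp add: ySuc)
  have "not_identically_zero (y (Suc (2 * \<mu>)))" if "\<not> not_identically_zero (y \<mu>)"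
  proof -
    have "not_identically_zero (y 1)"
    proof (rule ccontr)
      assume "\<not> not_identically_zero (y 1)"
      hence "y (Suc \<mu>) \<tau> z = 0" if "Im \<tau> > 0" for \<tau> z
        using hecke_recursion_zero[of p k y c, OF p0 rec y0 _ that]
        unfolding not_identically_zero_def by blast
      with nz show False unfolding not_identically_zero_def by blast
    qed
    then obtain \<tau> z where z: "Im \<tau> > 0" "y 1 \<tau> z \<noteq> 0"
      unfolding not_identically_zero_def by blast
    \<comment> \<open>Undoes the scaling of the elliptic variable in the reflection formula.\<close>
    define z' where "z' = (1 / of_nat (p ^ \<mu>)) *s z"
    have "of_nat (p ^ \<mu>) *s z' = z" using p0 by (simp add: z'_def vec_eq_iff)
    moreover have "y (2 * \<mu> + 1) \<tau> z' = c ^ \<mu> * y 1 \<tau> (of_nat (p ^ \<mu>) *s z')"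
      using that assms(8) z(1) unfolding not_identically_zero_def
      by (intro hecke_recursion_reflect[of p k y c, OF p0 rec y0]) auto
    ultimately have "y (Suc (2 * \<mu>)) \<tau> z' \<noteq> 0" using z(2) c by simp
    with z(1) show ?thesis unfolding not_identically_zero_def by blast
  qed
  moreover have "not_identically_zero
            (jacobi_poincare k (real p ^ (2 * \<mu>) *\<^sub>R m) n (int p ^ \<mu> *s r))"
  proof (rule ccontr)
    let ?m = "real p ^ (2 * \<mu>) *\<^sub>R m" and ?r = "int p ^ \<mu> *s r"
    assume zero: "\<not> not_identically_zero (jacobi_poincare k ?m n ?r)"
    have sq: "real (p ^ \<mu>) ^ 2 = real p ^ (2 * \<mu>)"
      by (metis mult.commute of_nat_power power_mult)
    \<comment> \<open>The data \<open>(n, p^\<mu> r)\<close> of index \<open>p^(2\<mu>) m\<close>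
      satisfy the same hypotheses, so a second sequence starts from them; its first term is assumed
      to vanish.\<close>
    have m': "jacobi_datum ?m n ?r"
      using jacobi_datum_square[OF m N0] unfolding sq by simp
    have "divides_entries p ?m"
      unfolding divides_entries_def
    proof (intro allI)
      fix i j
      obtain d :: int where "2 * m $ i $ j = of_int (int p * d)"
        using assms(9) unfolding divides_entries_def by blast
      hence "2 * ?m $ i $ j = of_int (int p * (int p ^ (2 * \<mu>) * d))" by (simp add: mult_ac)
      thus "\<exists>d :: int. 2 * ?m $ i $ j = of_int (int p * d)" by blast
    qed
    moreover have "\<forall>i. int p dvd ?r $ i" using assms(10) by simp
    ultimately have rec': "hecke_V p k (poincare_seq k ?m n ?r p (Suc j)) \<tau> z
        = poincare_seq k ?m n ?r p (Suc (Suc j)) \<tau> z + c * poincare_seq k ?m n ?r p j \<tau> (of_nat p *s z)"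
      if "Im \<tau> > 0" for j \<tau> z
      unfolding c_def by (intro poincare_seq_recursion m' k p assms(11) that)
    have "poincare_seq k ?m n ?r p (Suc \<mu>) \<tau> z = 0" if "Im \<tau> > 0" for \<tau> z
    proof (rule hecke_recursion_zero[of p k "poincare_seq k ?m n ?r p" c, OF p0 rec' _ _ that])
      show "poincare_seq k ?m n ?r p 1 \<tau> z = 0" if "Im \<tau> > 0" for \<tau> z
        using zero that by (simp add: poincare_seq_def not_identically_zero_def)
    qed (auto simp: poincare_seq_def)
    \<comment> \<open>The vanishing term has index \<open>p^(3\<mu>) m\<close>, here read as the
      square of \<open>p^\<mu>\<close> times \<open>p^\<mu> m\<close>, the shape needed for the
      descent to \<open>y (Suc \<mu>)\<close>.\<close>
    hence "jacobi_poincare k (real (p ^ \<mu>) ^ 2 *\<^sub>R (real p ^ \<mu> *\<^sub>R m)) (p ^ \<mu> * n)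
        (int (p ^ \<mu>) *s (int p ^ \<mu> *s r)) \<tau> z = 0" if "Im \<tau> > 0" for \<tau> z
      using that unfolding sq by (simp add: poincare_seq_def mult.commute[of _ "real p ^ \<mu>"])
    moreover have "jacobi_datum (real p ^ \<mu> *\<^sub>R m) (p ^ \<mu> * n) (int p ^ \<mu> *s r)"
      using jacobi_datum_scale[OF m N0] by simp
    ultimately have "y (Suc \<mu>) \<tau> z = 0" if "Im \<tau> > 0" for \<tau> z
      unfolding ySuc using poincare_zero_descent k N0 that by blast
    with nz show False unfolding not_identically_zero_def by blast
  qed
  ultimately show ?thesis
    using assms(8) ySuc[of "\<mu> - 1"] by (auto simp: ySuc)
qed

end
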